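(* Let $p>2$ be an odd integer and $c>0$ a real number. Then all minimal convex generators of $E(pc/2,c)$ are of the form \[ e_{1,0}^k\, e_{\frac{p+1}{2},1}^{m_1}\, e_{p,2}^d\, e_{\frac{p-1}{2},1}^{m_2}, \] where $k,m_1,d,m_2$ are integers with $m_1,m_2\in\{0,1\}$, $d\ge 0$, $0\le k<\frac{p-1}{2}$ if $m_1=1$, and $0\le k<\frac{p+1}{2}$ if $m_1=0$.
   Context: A convex integral path is a path $\Lambda$ in the plane with endpoints $(0,y(\Lambda))$ and $(x(\Lambda),0)$, where $x(\Lambda),y(\Lambda)\ge 0$ are integers, which is the graph of a piecewise linear concave function $f:[0,x(\Lambda)]\to[0,y(\Lambda)]$ with $f'(0)\le 0$, possibly together with a vertical line segment at the right, and all of whose vertices (endpoints and points of slope change) are lattice points; its edges are the segments between consecutive vertices. A convex generator is a convex integral path each of whose edges is labeled "$e$" or "$h$", with horizontal and vertical edges labeled only "$e$". For relatively prime nonnegative integers $r,s$ and a positive integer $m$, $e_{r,s}^m$ denotes an edge with displacement vector $(mr,-ms)$ labeled "$e$"; exponent $0$ means the factor is absent. A convex generator all of whose edges are labeled "$e$" (purely elliptic) is identified with the commutative formal product of the symbols of its edges. $L(\Lambda)$ is the number of lattice points in the region enclosed by $\Lambda$ and the axes, boundary included; $h(\Lambda)$ is the number of edges labeled "$h$"; the ECH index is $I(\Lambda)=2(L(\Lambda)-1)-h(\Lambda)$. For the ellipsoid $E(r,s)$ (the toric domain over the triangle with vertices $(0,0),(r,0),(0,s)$) the symplectic action of $\Lambda$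 is $A_{E(r,s)}(\Lambda)=\max\{sx+ry:(x,y)\in\Lambda\}$. A convex generator $\Lambda$ is minimal for $E(r,s)$ if it is purely elliptic and uniquely minimizes $A_{E(r,s)}$ among all purely elliptic convex generators with the same ECH index as $\Lambda$. *)

theory Defs
  imports "HOL-Analysis.Analysis" "HOL-Library.Multiset"
begin

section \<open>Convex integral paths\<close>

definition piecewise_linear_on :: "real \<Rightarrow> real \<Rightarrow> (real \<Rightarrow> real) \<Rightarrow> bool" where
  "piecewise_linear_on a b f \<longleftrightarrow>
     (\<exists>ts. ts \<noteq> [] \<and> sorted ts \<and> hd ts = a \<and> last ts = b \<and>
           (\<forall>i. Suc i < length ts \<longrightarrow>
              (\<exists>m q. \<forall>t\<in>{ts ! i .. ts ! Suc i}. f t = m * t + q)))"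

text \<open>
  For a path \<open>\<Lambda>\<close>, the endpoints and the points of slope change are exactly the points of
  \<open>\<Lambda>\<close> which do not lie strictly inside a line segment contained in \<open>\<Lambda>\<close>.
\<close>

definition path_vertices :: "(real \<times> real) set \<Rightarrow> (real \<times> real) set" where
  "path_vertices \<Lambda> =
     {v \<in> \<Lambda>. \<not> (\<exists>a b. closed_segment a b \<subseteq> \<Lambda> \<and> v \<in> open_segment a b)}"

text \<open>
  The last set in the union is the possible vertical segment at the right; it degenerates to
  the endpoint \<open>(X, 0)\<close> if \<open>f X = 0\<close>. For \<open>X = 0\<close> the path is the vertical segment from
  \<open>(0, Y)\<close> to the origin; the condition on the derivative is then void, as
  \<open>at 0 within {0}\<close> is the trivial filter.
\<close>

definition convex_integral_path :: "(real \<times> real) set \<Rightarrow> bool" where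
  "convex_integral_path \<Lambda> \<longleftrightarrow>
     (\<exists>(X::nat) (Y::nat) (f :: real \<Rightarrow> real).
        piecewise_linear_on 0 (real X) f \<and>
        concave_on {0..real X} f \<and>
        f ` {0..real X} \<subseteq> {0..real Y} \<and>
        f 0 = real Y \<and>
        (\<exists>D\<le>0. (f has_real_derivative D) (at 0 within {0..real X})) \<and>
        \<Lambda> = (\<lambda>t. (t, f t)) ` {0..real X} \<union> {real X} \<times> {0..f (real X)}) \<and>
     path_vertices \<Lambda> \<subseteq> \<int> \<times> \<int>"

text \<open>
  An edge is the pair \<open>(v, w)\<close> of its ends, listed along the path from \<open>(0, y(\<Lambda>))\<close> to
  \<open>(x(\<Lambda>), 0)\<close>. Two vertices joined by a segment inside \<open>\<Lambda>\<close> are automatically consecutive,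
  since no vertex lies strictly inside such a segment.
\<close>

definition path_edges :: "(real \<times> real) set \<Rightarrow> ((real \<times> real) \<times> (real \<times> real)) set" where
  "path_edges \<Lambda> =
     {(v, w). v \<in> path_vertices \<Lambda> \<and> w \<in> path_vertices \<Lambda> \<and> v \<noteq> w \<and>
              fst v \<le> fst w \<and> snd w \<le> snd v \<and> closed_segment v w \<subseteq> \<Lambda>}"


section \<open>Convex generators\<close>

text \<open>The labeling is given by the set of edges labeled \<open>h\<close>; all other edges are labeled \<open>e\<close>.\<close>

record generator =
  gpath :: "(real \<times> real) set"
  hedges :: "((real \<times> real) \<times> (real \<times> real)) set"

definition convex_generator :: "generator \<Rightarrow> bool" where
  "convex_generator G \<longleftrightarrow>
     convex_integral_path (gpath G) \<and>
     hedges G \<subseteq> path_edges (gpath G) \<and>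
     (\<forall>(v, w)\<in>hedges G. fst v \<noteq> fst w \<and> snd v \<noteq> snd w)"

definition purely_elliptic :: "generator \<Rightarrow> bool" where
  "purely_elliptic G \<longleftrightarrow> hedges G = {}"

text \<open>
  The formal product of the edge symbols is a multiset of pairs \<open>(r, s)\<close> of coprime naturals,
  with \<open>m\<close> copies of \<open>(r, s)\<close> standing for the factor \<open>e\<^bsub>r,s\<^esub>\<^sup>m\<close>. An edge with displacement
  \<open>(a, -b)\<close> contributes \<open>e\<^bsub>a/g,b/g\<^esub>\<^sup>g\<close> for \<open>g = gcd a b\<close>. The coordinates of edge ends are
  integers, so that the floors are exact.
\<close>

definition edge_symbol :: "(real \<times> real) \<times> (real \<times> real) \<Rightarrow> (nat \<times> nat) multiset" where
  "edge_symbol = (\<lambda>(v, w).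
     let a = nat \<lfloor>fst w - fst v\<rfloor>; b = nat \<lfloor>snd v - snd w\<rfloor>; g = gcd a b
     in replicate_mset g (a div g, b div g))"

definition formal_product :: "generator \<Rightarrow> (nat \<times> nat) multiset" where
  "formal_product G = (\<Sum>\<epsilon>\<in>path_edges (gpath G). edge_symbol \<epsilon>)"

definition enclosed_region :: "(real \<times> real) set \<Rightarrow> (real \<times> real) set" where
  "enclosed_region \<Lambda> = {(x, y). 0 \<le> x \<and> 0 \<le> y \<and> (\<exists>y'\<ge>y. (x, y') \<in> \<Lambda>)}"

definition lattice_count :: "generator \<Rightarrow> nat" where
  "lattice_count G =
     card {(i::int, j::int). (real_of_int i, real_of_int j) \<in> enclosed_region (gpath G)}"

definition ech_index :: "generator \<Rightarrow> int" where
  "ech_index G = 2 * (int (lattice_count G) - 1) - int (card (hedges G))"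


section \<open>Minimal generators for ellipsoids\<close>

text \<open>The supremum is a maximum, since a convex integral path is compact and nonempty.\<close>

definition ellipsoid_action :: "real \<Rightarrow> real \<Rightarrow> generator \<Rightarrow> real" where
  "ellipsoid_action r s G = (SUP (x, y)\<in>gpath G. s * x + r * y)"

definition minimal_for_ellipsoid :: "real \<Rightarrow> real \<Rightarrow> generator \<Rightarrow> bool" where
  "minimal_for_ellipsoid r s G \<longleftrightarrow>
     convex_generator G \<and> purely_elliptic G \<and>
     (\<forall>G'. convex_generator G' \<and> purely_elliptic G' \<and> ech_index G' = ech_index G \<and> G' \<noteq> G \<longrightarrow>
           ellipsoid_action r s G < ellipsoid_action r s G')"

end

(*
  Up to the factor c/2 the action of a generator is the maximum of the weight 2x + py over its
  lattice points. Let N be this maximum for a minimal generator G. Ordering the lattice points of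
  the triangle 2x + py <= N by weight, with ties broken by increasing or by decreasing x, and
  keeping as many of them as G encloses, gives two generators with the index of G and action at
  most that of G; both must equal G, which is only possible if G encloses the whole triangle.
  The edges of the upper hull of this triangle can be read off its rows: lowering the row by 2
  extends its reach by exactly p, and lowering it by 1 by (p + 1)/2 or (p - 1)/2, alternately.
*)
theory Submission
  imports Defs
begin

section \<open>Graphs of concave functions as convex integral paths\<close>

text \<open>The tie-breaking orders have to yield convex generators, not just sets of lattice
  points. They do, because each of them is itself a linear weight: the original one multiplied by
  \<open>N + 2\<close>, plus or minus \<open>x\<close>. An initial segment is then again the set of
  lattice points of a triangle, so its concave hull adds no lattice point and the index comes out as
  prescribed. The action of the hull is still measured by the original weight; this is why hulls are
  required to inherit linear bounds from their lattice points.

  A single order would show only that \<open>G\<close> encloses an initial segment, which may stop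
  in the middle of the line of weight \<open>N\<close>. A lattice point of the triangle missed by
  \<open>G\<close> would come after an enclosed point of weight \<open>N\<close> in both orders,
  hence lie both to the right and to the left of it.

  The path of \<open>G\<close> is never reconstructed from its lattice points. An explicit four-edge
  polygon with the same lattice points is built, and uniqueness of the minimizer identifies it with
  \<open>G\<close>; edges are computed for this polygon only.\<close>

definition graph_path :: "nat \<Rightarrow> (real \<Rightarrow> real) \<Rightarrow> (real \<times> real) set" where
  "graph_path X f = (\<lambda>t. (t, f t)) ` {0..real X} \<union> {real X} \<times> {0..f (real X)}"

definition lattice_set :: "(real \<times> real) set \<Rightarrow> (int \<times> int) set" where
  "lattice_set \<Lambda> = {(i, j). (real_of_int i, real_of_int j) \<in> enclosed_region \<Lambda>}"

lemma lattice_count_eq: "lattice_count G = card (lattice_set (gpath G))"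
  by (simp add: lattice_count_def lattice_set_def)

lemma lattice_set_graph_path:
  "lattice_set (graph_path X f) =
     {(i, j). 0 \<le> i \<and> i \<le> int X \<and> 0 \<le> j \<and> real_of_int j \<le> f (real_of_int i)}"
proof -
  have "(\<exists>y'\<ge>y. (x, y') \<in> graph_path X f) \<longleftrightarrow> x \<le> real X \<and> y \<le> f x" if "0 \<le> x" "0 \<le> y" for x y
    using that by (auto simp: graph_path_def)
  then have "(real_of_int i, real_of_int j) \<in> enclosed_region (graph_path X f) \<longleftrightarrow>
      0 \<le> i \<and> i \<le> int X \<and> 0 \<le> j \<and> real_of_int j \<le> f (real_of_int i)" for i j
    unfolding enclosed_region_def by (auto, (metis of_int_0_le_iff of_int_le_iff of_int_of_nat_eq)+)
  then show ?thesis by (auto simp: lattice_set_def)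
qed

lemma graph_in_segment:
  fixes f :: "real \<Rightarrow> real"
  assumes "a \<le> b" and aff: "\<And>t. t \<in> {a..b} \<Longrightarrow> f t = m * t + q"
  shows "closed_segment (a, f a) (b, f b) = (\<lambda>t. (t, f t)) ` {a..b}"
    and "\<And>t. a < t \<Longrightarrow> t < b \<Longrightarrow> (t, f t) \<in> open_segment (a, f a) (b, f b)"
proof -
  have pt: "(1 - u) *\<^sub>R (a, f a) + u *\<^sub>R (b, f b) = ((1 - u) * a + u * b, f ((1 - u) * a + u * b))"
    if "0 \<le> u" "u \<le> 1" for u
  proof -
    have "(1 - u) * a + u * b \<in> {a..b}"
      using convexD_alt[of "{a..b}" a b u] that \<open>a \<le> b\<close> by simp
    then show ?thesis using \<open>a \<le> b\<close> aff by (simp add: algebra_simps)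
  qed
  have img: "closed_segment a b = {a..b}" using \<open>a \<le> b\<close> by (simp add: closed_segment_eq_real_ivl)
  have "closed_segment (a, f a) (b, f b) = (\<lambda>t. (t, f t)) ` closed_segment a b"
    unfolding closed_segment_image_interval using pt
    by (simp add: pt image_image)
  then show *: "closed_segment (a, f a) (b, f b) = (\<lambda>t. (t, f t)) ` {a..b}" using img by simp
  show "(t, f t) \<in> open_segment (a, f a) (b, f b)" if "a < t" "t < b" for t
    using that by (auto simp: open_segment_def *)
qed

text \<open>On the piece \<open>u * t + v * f t\<close> is affine in \<open>t\<close>, so a bound at
  both ends holds in between. The sign of \<open>v\<close> is left open, since
  \<open>v = - 1\<close> turns this into a lower bound for \<open>f\<close>.\<close>

lemma affine_piece_le:
  fixes f :: "real \<Rightarrow> real"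
  assumes "t \<in> {a..b}" and aff: "\<And>t. t \<in> {a..b} \<Longrightarrow> f t = m * t + q"
    and "u * a + v * f a \<le> B" "u * b + v * f b \<le> B"
  shows "u * t + v * f t \<le> B"
proof -
  have e: "u * t + v * f t = (u + v * m) * t + v * q" if "t \<in> {a..b}" for t
    using aff[OF that] by (simp add: algebra_simps)
  have ab: "a \<in> {a..b}" "b \<in> {a..b}" using assms(1) by auto
  show ?thesis
  proof (cases "u + v * m \<ge> 0")
    case True
    then have "(u + v * m) * t \<le> (u + v * m) * b" using assms(1) by (simp add: mult_left_mono)
    then show ?thesis using e[OF assms(1)] e[OF ab(2)] assms(4) by linarith
  next
    case False
    then have "(u + v * m) * t \<le> (u + v * m) * a" using assms(1) by (simp add: mult_left_mono_neg)
    then show ?thesis using e[OF assms(1)] e[OF ab(1)] assms(3) by linarith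
  qed
qed

lemma real_between_nats:
  assumes "0 \<le> t" "t \<le> real X" "0 < X"
  obtains n where "n < X" "real n \<le> t" "t \<le> real (Suc n)"
proof (cases "t = real X")
  case True
  then show ?thesis using that[of "X - 1"] assms by auto
next
  case False
  have "real (nat \<lfloor>t\<rfloor>) \<le> t" "t < real (nat \<lfloor>t\<rfloor>) + 1" using assms by linarith+
  moreover have "nat \<lfloor>t\<rfloor> < X" using False assms by linarith
  ultimately show ?thesis using that[of "nat \<lfloor>t\<rfloor>"] by (metis add.commute less_eq_real_def of_nat_Suc)
qed

text \<open>The breakpoints are never listed: \<open>pieces\<close> asks only that each unit
  interval lie in some affine piece with integer ends and integer values there, and these pieces may
  overlap. A vertex cannot lie strictly inside a piece, because the piece traces a segment of the
  path; so it is an end of a piece or lies over \<open>X\<close>.\<close>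

lemma convex_integral_path_graph:
  assumes conc: "concave_on {0..real X} f"
    and f0: "f 0 = real Y"
    and bnd: "\<And>t. t \<in> {0..real X} \<Longrightarrow> 0 \<le> f t \<and> f t \<le> real Y"
    and pieces: "\<And>n. n < X \<Longrightarrow> \<exists>i j m q. i \<le> n \<and> n < j \<and> j \<le> X \<and> f (real i) \<in> \<int> \<and> f (real j) \<in> \<int> \<and>
                  (\<forall>t\<in>{real i..real j}. f t = m * t + q)"
  shows "convex_integral_path (graph_path X f)"
proof -
  \<comment> \<open>All integers serve as nodes; \<open>piecewise_linear_on\<close> does not demand
    a change of slope at a node.\<close>
  let ?ts = "map real [0..<Suc X]"
  have "\<exists>m q. \<forall>t\<in>{?ts ! i .. ?ts ! Suc i}. f t = m * t + q" if "Suc i < length ?ts" for i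
  proof -
    have "i < X" using that by simp
    from pieces[OF this] obtain i' j m q where *: "i' \<le> i" "i < j" "\<forall>t\<in>{real i'..real j}. f t = m * t + q"
      by blast
    have "?ts ! i = real i" "?ts ! Suc i = real (Suc i)" using \<open>i < X\<close> by (simp_all del: upt_Suc)
    then have "{?ts ! i .. ?ts ! Suc i} \<subseteq> {real i'..real j}" using * by auto
    then show ?thesis using * by blast
  qed
  moreover have "sorted ?ts" by (simp add: sorted_map del: upt_Suc)
  moreover have "hd ?ts = 0" by (simp add: hd_map del: upt_Suc)
  moreover have "last ?ts = real X" by simp
  ultimately have pl: "piecewise_linear_on 0 (real X) f"
    unfolding piecewise_linear_on_def by (intro exI[of _ ?ts]) auto
  have der: "\<exists>D\<le>0. (f has_real_derivative D) (at 0 within {0..real X})"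
  proof (cases "X = 0")
    case True
    have "at 0 within {0::real} = bot" by (simp add: at_within_eq_bot_iff)
    then show ?thesis using True
      by (intro exI[of _ 0]) (simp add: has_field_derivative_iff)
  next
    case False
    from pieces[of 0] False obtain j m q where *: "0 < j" "j \<le> X" "\<forall>t\<in>{0..real j}. f t = m * t + q"
      by auto
    \<comment> \<open>The maximal value \<open>Y\<close> is taken at 0, so the first slope cannot be
      positive.\<close>
    have "f (real j) \<le> f 0" using bnd[of "real j"] f0 * by auto
    then have "m * real j \<le> 0" using * by simp
    then have "m \<le> 0" using * by (simp add: mult_le_0_iff)
    have "((\<lambda>t. m * t + q) has_real_derivative m) (at 0 within {0..real X})"
      by (auto intro!: derivative_eq_intros)
    then have "(f has_real_derivative m) (at 0 within {0..real X})"
      by (rule has_field_derivative_transform_within[of _ _ _ _ "real j"]) (use * in \<open>auto simp: dist_real_def\<close>)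
    then show ?thesis using \<open>m \<le> 0\<close> by blast
  qed
  have fX: "f (real X) \<in> \<int>"
  proof (cases "X = 0")
    case False
    then obtain j where "X - 1 < j" "j \<le> X" "f (real j) \<in> \<int>" using pieces[of "X - 1"] by auto
    then have "j = X" by linarith
    then show ?thesis using \<open>f (real j) \<in> \<int>\<close> by simp
  qed (simp add: f0)
  have seg: "\<not> (i < t \<and> t < j)" if "(t, f t) \<in> path_vertices (graph_path X f)" "0 \<le> i" "j \<le> real X"
       "\<forall>t\<in>{i..j}. f t = m * t + q" for t i j m q
  proof
    assume t: "i < t \<and> t < j"
    then have "i \<le> j" by simp
    note s = graph_in_segment[OF this, of f m q]
    have "closed_segment (i, f i) (j, f j) \<subseteq> graph_path X f"
      using s(1) that by (auto simp: graph_path_def)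
    moreover have "(t, f t) \<in> open_segment (i, f i) (j, f j)" using s(2) t that by blast
    ultimately show False using that(1) by (auto simp: path_vertices_def)
  qed
  have vert: "(t, y) \<in> \<int> \<times> \<int>" if v: "(t, y) \<in> path_vertices (graph_path X f)" for t y
  proof -
    have mem: "(t, y) \<in> graph_path X f" using v by (simp add: path_vertices_def)
    then have tX: "0 \<le> t" "t \<le> real X" by (auto simp: graph_path_def)
    show ?thesis
    proof (cases "t = real X")
      case True
      have "\<not> (0 < y \<and> y < f (real X))"
      proof
        assume y: "0 < y \<and> y < f (real X)"
        have sg: "closed_segment (real X, 0) (real X, f (real X)) = {real X} \<times> {0..f (real X)}"
          using y by (simp add: closed_segment_PairD closed_segment_eq_real_ivl closed_segment_same_fst) 
        then have "(t, y) \<in> open_segment (real X, 0) (real X, f (real X))"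
          using True y by (auto simp: open_segment_def)
        moreover have "closed_segment (real X, 0) (real X, f (real X)) \<subseteq> graph_path X f"
          unfolding sg by (auto simp: graph_path_def)
        ultimately show False using v by (auto simp: path_vertices_def)
      qed
      moreover have "0 \<le> y \<and> y \<le> f (real X)"
        using mem True bnd[of "real X"] by (auto simp: graph_path_def)
      ultimately have "y = 0 \<or> y = f (real X)" by linarith
      then show ?thesis using True fX by auto
    next
      case False
      then have y: "y = f t" using mem by (auto simp: graph_path_def)
      then have "0 < X" using tX False by (cases "X = 0") auto
      then obtain n where n: "n < X" "real n \<le> t" "t \<le> real (Suc n)"
        using real_between_nats[of t X] tX by blast
      \<comment> \<open>The unit interval is made half-open on the right, so that an integer
        \<open>t\<close> is assigned to the piece beginning there. Then \<open>t < real j\<close>,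
        and \<open>t\<close> can fail to be interior to the piece only by being its left
        end.\<close>
      obtain n' where n': "n' < X" "real n' \<le> t" "t < real (Suc n')"
      proof (cases "t = real (Suc n)")
        case True
        then have "Suc n < X" using n False by (cases "Suc n = X") auto
        then show ?thesis using that[of "Suc n"] True by simp
      qed (use that n in auto)
      obtain i j m q where *: "i \<le> n'" "n' < j" "j \<le> X" "f (real i) \<in> \<int>" "f (real j) \<in> \<int>"
         "\<forall>t\<in>{real i..real j}. f t = m * t + q" using pieces[OF n'(1)] by blast
      have "\<not> (real i < t \<and> t < real j)" using seg[of t "real i" "real j" m q] v y * by auto
      moreover have "real i \<le> t" "t < real j" using * n' by linarith+
      ultimately have "t = real i" by linarith
      then show ?thesis using * y by auto
    qed
  qed
  have rng: "f ` {0..real X} \<subseteq> {0..real Y}" using bnd by auto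
  have "path_vertices (graph_path X f) \<subseteq> \<int> \<times> \<int>" using vert by auto
  then show ?thesis
    unfolding convex_integral_path_def using pl conc rng f0 der graph_path_def by blast
qed

section \<open>Concave hulls\<close>

text \<open>Concave functions are encoded as finite minima of lines: concavity is then automatic,
  and an upper bound by the function splits into one linear inequality per line.\<close>

definition envelope :: "nat \<Rightarrow> (nat \<Rightarrow> real) \<Rightarrow> (nat \<Rightarrow> real) \<Rightarrow> real \<Rightarrow> real" where
  "envelope n m q t = Min ((\<lambda>a. m a * t + q a) ` {..<n})"

lemma envelope_le: "a < n \<Longrightarrow> envelope n m q t \<le> m a * t + q a"
  by (auto simp: envelope_def)

lemma envelope_eqI:
  assumes "a < n" "\<And>b. b < n \<Longrightarrow> m a * t + q a \<le> m b * t + q b"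
  shows "envelope n m q t = m a * t + q a"
  unfolding envelope_def using assms by (intro Min_eqI) auto

lemma envelope_ge:
  assumes "0 < n" "\<And>b. b < n \<Longrightarrow> z \<le> m b * t + q b"
  shows "z \<le> envelope n m q t"
  unfolding envelope_def using assms by (subst Min_ge_iff) auto

lemma concave_on_envelope:
  assumes "0 < n" "convex S"
  shows "concave_on S (envelope n m q)"
  unfolding concave_on_iff
proof (intro conjI ballI allI impI)
  fix x y u v :: real
  assume *: "x \<in> S" "y \<in> S" "0 \<le> u" "0 \<le> v" "u + v = 1"
  show "u * envelope n m q x + v * envelope n m q y \<le> envelope n m q (u *\<^sub>R x + v *\<^sub>R y)"
  proof (rule envelope_ge[OF assms(1)])
    fix b assume "b < n"
    then have "u * envelope n m q x + v * envelope n m q y \<le> u * (m b * x + q b) + v * (m b * y + q b)"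
      using * by (intro add_mono mult_left_mono envelope_le) auto
    also have "\<dots> = m b * (u * x + v * y) + (u + v) * q b" by (simp add: algebra_simps)
    finally show "u * envelope n m q x + v * envelope n m q y \<le> m b * (u *\<^sub>R x + v *\<^sub>R y) + q b"
      using * by simp
  qed
qed (rule assms)

lemma line_le_lineI:
  fixes m q m' q' :: real
  assumes "t \<in> {a..b}" "m * a + q \<le> m' * a + q'" "m * b + q \<le> m' * b + q'"
  shows "m * t + q \<le> m' * t + q'"
proof (cases "m \<le> m'")
  case True
  then have "(m' - m) * a \<le> (m' - m) * t" using assms by (intro mult_left_mono) auto
  then show ?thesis using assms by (simp add: algebra_simps)
next
  case False
  then have "(m - m') * t \<le> (m - m') * b" using assms by (intro mult_left_mono) auto
  then show ?thesis using assms by (simp add: algebra_simps)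
qed

text \<open>Among all chords crossing \<open>n + 1/2\<close>, one that is highest there supports the whole data set.\<close>

lemma supporting_line_exists:
  fixes h :: "nat \<Rightarrow> real"
  assumes "n < X"
  obtains i j m q where "i \<le> n" "n < j" "j \<le> X" "h i = m * real i + q" "h j = m * real j + q"
    "\<And>k. k \<le> X \<Longrightarrow> h k \<le> m * real k + q"
proof -
  define \<tau> where "\<tau> = real n + 1/2"
  \<comment> \<open>\<open>V (i, j)\<close> is the height at \<tau> of the chord from
    \<open>(i, h i)\<close> to \<open>(j, h j)\<close>. As \<tau> is no integer, both weights in the
    numerator are positive.\<close>
  define V where "V = (\<lambda>(i, j). (h i * (real j - \<tau>) + h j * (\<tau> - real i)) / (real j - real i))"
  let ?P = "{..n} \<times> {Suc n..X}"
  have "finite ?P" "?P \<noteq> {}" using assms by auto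
  then have "Max (V ` ?P) \<in> V ` ?P" by (intro Max_in) auto
  then obtain i j where ij: "(i, j) \<in> ?P" and "V (i, j) = Max (V ` ?P)" by force
  then have mx: "V (i', j') \<le> V (i, j)" if "(i', j') \<in> ?P" for i' j'
    using that \<open>finite ?P\<close> by simp
  from ij have le: "i \<le> n" "n < j" "j \<le> X" by auto
  then have ne: "real j - real i > 0" by simp
  define m where "m = (h j - h i) / (real j - real i)"
  define q where "q = h i - m * real i"
  have hi: "h i = m * real i + q" by (simp add: q_def)
  have "m * (real j - real i) = h j - h i" using ne by (simp add: m_def)
  then have hj: "h j = m * real j + q" by (simp add: q_def algebra_simps)
  \<comment> \<open>Relative to the line through the best chord, the height of another chord at
    \<tau> is a weighted mean of the excesses of its two ends. Replacing one end of the best chord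
    by a point above the line would therefore give a higher chord.\<close>
  have V: "V (i', j') = m * \<tau> + q + ((h i' - (m * real i' + q)) * (real j' - \<tau>)
       + (h j' - (m * real j' + q)) * (\<tau> - real i')) / (real j' - real i')" if "i' < j'" for i' j'
    using that unfolding V_def by (simp add: field_simps)
  have Vij: "V (i, j) = m * \<tau> + q" using V[of i j] le hi hj by simp
  have "h k \<le> m * real k + q" if "k \<le> X" for k
  proof (rule ccontr)
    assume "\<not> h k \<le> m * real k + q"
    then have g: "h k - (m * real k + q) > 0" by simp
    show False
    proof (cases "k \<le> n")
      case True
      have "(h k - (m * real k + q)) * (real j - \<tau>) / (real j - real k) > 0"
        using g True le by (intro divide_pos_pos mult_pos_pos) (auto simp: \<tau>_def)
      then have "V (k, j) > V (i, j)" using V[of k j] Vij hj True le by simp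
      then show False using mx[of k j] True le by simp
    next
      case False
      have "(h k - (m * real k + q)) * (\<tau> - real i) / (real k - real i) > 0"
        using g False le by (intro divide_pos_pos mult_pos_pos) (auto simp: \<tau>_def)
      then have "V (i, k) > V (i, j)" using V[of i k] Vij hi False le by simp
      then show False using mx[of i k] False le that by simp
    qed
  qed
  with le hi hj that show ?thesis by blast
qed

text \<open>The function is the envelope of one supporting line for each unit interval. At both
  contact points of the \<open>n\<close>-th line this line equals \<open>h\<close>, which every
  other line dominates; so it is the lowest line between them, and the envelope is affine
  there.\<close>

lemma concave_hull_exists:
  fixes h :: "nat \<Rightarrow> real"
  obtains f where "concave_on {0..real X} f" "f 0 = h 0"
    "\<And>k. k \<le> X \<Longrightarrow> h k \<le> f (real k)"
    "\<And>n. n < X \<Longrightarrow> \<exists>i j m q. i \<le> n \<and> n < j \<and> j \<le> X \<and> f (real i) = h i \<and> f (real j) = h j \<and>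
                  (\<forall>t\<in>{real i..real j}. f t = m * t + q)"
proof (cases "X = 0")
  case True
  then show ?thesis by (intro that[of "\<lambda>_. h 0"]) (auto simp: concave_on_const)
next
  case False
  have "\<forall>n. \<exists>i j m q. n < X \<longrightarrow> i \<le> n \<and> n < j \<and> j \<le> X \<and> h i = m * real i + q \<and> h j = m * real j + q \<and>
     (\<forall>k\<le>X. h k \<le> m * real k + q)"
    by (metis supporting_line_exists)
  then obtain i j m q where *: "\<And>n. n < X \<Longrightarrow> i n \<le> n \<and> n < j n \<and> j n \<le> X \<and>
     h (i n) = m n * real (i n) + q n \<and> h (j n) = m n * real (j n) + q n \<and>
     (\<forall>k\<le>X. h k \<le> m n * real k + q n)"
    by metis
  define f where "f = envelope X m q"
  have on: "f t = m n * t + q n" if "n < X" "t \<in> {real (i n)..real (j n)}" for n t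
    unfolding f_def
  proof (rule envelope_eqI[OF that(1)])
    fix b assume "b < X"
    have "i n \<le> X" "j n \<le> X" using *[OF that(1)] that(1) by auto
    then have "h (i n) \<le> m b * real (i n) + q b" "h (j n) \<le> m b * real (j n) + q b"
      using *[OF \<open>b < X\<close>] by blast+
    then show "m n * t + q n \<le> m b * t + q b"
      using *[OF that(1)] by (intro line_le_lineI[OF that(2)]) linarith+
  qed
  have ends: "f (real (i n)) = h (i n)" "f (real (j n)) = h (j n)" if "n < X" for n
    using *[OF that] on[OF that, of "real (i n)"] on[OF that, of "real (j n)"] by auto
  show ?thesis
  proof (rule that[of f])
    show "concave_on {0..real X} f" unfolding f_def using False by (intro concave_on_envelope) auto
    show "f 0 = h 0" using ends(1)[of 0] *[of 0] False by (metis bot_nat_0.not_eq_extremum le_zero_eq of_nat_0)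
    show "h k \<le> f (real k)" if "k \<le> X" for k
      unfolding f_def using False that * by (intro envelope_ge) auto
    show "\<exists>i j m q. i \<le> n \<and> n < j \<and> j \<le> X \<and> f (real i) = h i \<and> f (real j) = h j \<and>
                  (\<forall>t\<in>{real i..real j}. f t = m * t + q)" if "n < X" for n
      using *[OF that] ends[OF that] on[OF that] by blast
  qed
qed

section \<open>Initial segments of prescribed size in a finite linear order\<close>

lemma card_initial_segment:
  fixes g :: "'a \<Rightarrow> int"
  assumes "finite A" "inj_on g A" "0 < k" "k \<le> card A"
  obtains a where "a \<in> A" "card {b \<in> A. g b \<le> g a} = k"
proof -
  have "\<exists>a\<in>A. card {b \<in> A. g b \<le> g a} = k"
    using assms
  proof (induction "card A" arbitrary: A)
    case (Suc n)
    then have "A \<noteq> {}" by auto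
    then have "Max (g ` A) \<in> g ` A" using Suc.prems by (intro Max_in) auto
    then obtain z where z: "z \<in> A" "g z = Max (g ` A)" by force
    then have mx: "g b \<le> g z" if "b \<in> A" for b using that Suc.prems by simp
    show ?case
    proof (cases "k = card A")
      case True
      have "{b \<in> A. g b \<le> g z} = A" using mx by auto
      then show ?thesis using z(1) True by metis
    next
      case False
      have "n = card (A - {z})" using Suc z by simp
      moreover have "k \<le> card (A - {z})" using False Suc z by simp
      ultimately obtain a where a: "a \<in> A - {z}" "card {b \<in> A - {z}. g b \<le> g a} = k"
        using Suc.hyps(1)[of "A - {z}"] Suc.prems inj_on_subset[of g A "A - {z}"] by auto
      have "a \<in> A" "a \<noteq> z" using a by auto
      then have "g a \<noteq> g z" using z(1) Suc.prems(2) by (meson inj_onD)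
      then have "g a < g z" using mx[OF \<open>a \<in> A\<close>] by simp
      then have "{b \<in> A - {z}. g b \<le> g a} = {b \<in> A. g b \<le> g a}" by auto
      then show ?thesis using a by auto
    qed
  qed simp
  then show ?thesis using that by blast
qed

section \<open>Minimal generators fill a triangle\<close>

definition triangle :: "int \<Rightarrow> int \<Rightarrow> int \<Rightarrow> (int \<times> int) set" where
  "triangle a b N = {(i, j). 0 \<le> i \<and> 0 \<le> j \<and> a * i + b * j \<le> N}"

lemma triangle_le:
  assumes "(i, j) \<in> triangle a b N" "0 < a" "0 < b"
  shows "i \<le> N" "j \<le> N"
proof -
  have *: "0 \<le> i" "0 \<le> j" "a * i + b * j \<le> N" using assms by (auto simp: triangle_def)
  have "1 * i \<le> a * i" "1 * j \<le> b * j" using * assms by (intro mult_right_mono; simp)+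
  then show "i \<le> N" "j \<le> N" using * by linarith+
qed

lemma finite_triangle:
  assumes "0 < a" "0 < b"
  shows "finite (triangle a b N)"
proof (rule finite_subset)
  show "triangle a b N \<subseteq> {0..N} \<times> {0..N}"
  proof
    fix r assume "r \<in> triangle a b N"
    moreover obtain i j where "r = (i, j)" by force
    ultimately show "r \<in> {0..N} \<times> {0..N}"
      using triangle_le[of i j a b N] assms by (auto simp: triangle_def)
  qed
qed simp

lemma lattice_setE:
  assumes "(i, j) \<in> lattice_set \<Lambda>"
  obtains y where "0 \<le> i" "0 \<le> j" "real_of_int j \<le> y" "(real_of_int i, y) \<in> \<Lambda>"
proof -
  have "0 \<le> i \<and> 0 \<le> j \<and> (\<exists>y\<ge>real_of_int j. (real_of_int i, y) \<in> \<Lambda>)"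
    using assms by (simp add: lattice_set_def enclosed_region_def)
  then show ?thesis using that by blast
qed

lemma int_le_div_iff: "i \<le> n div b \<longleftrightarrow> b * i \<le> n" if "0 < b" for i n b :: int
proof
  assume "i \<le> n div b"
  then have "b * i \<le> b * (n div b)" using that by (intro mult_left_mono) auto
  also have "\<dots> \<le> n" using that by (metis mult.commute mult_div_mod_eq pos_mod_sign le_add_same_cancel1)
  finally show "b * i \<le> n" .
next
  assume "b * i \<le> n"
  from zdiv_mono1[OF this that] show "i \<le> n div b" using that by simp
qed

text \<open>The path is the concave hull of the column heights of the triangle. Its last property
  says that linear bounds pass from the lattice points to the path; it is stated for arbitrary
  coefficients because the hull of a tilted triangle will be measured with the untilted weight. The
  condition \<open>0 \<le> v\<close> accounts for the vertical segment at the right, which lies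
  below the end of the graph.\<close>

lemma triangle_generator:
  fixes a b N :: int
  assumes "0 < a" "0 < b" "0 \<le> N"
  obtains G where "convex_generator G" "hedges G = {}" "lattice_set (gpath G) = triangle a b N"
    "\<forall>u v B x y. 0 \<le> v \<longrightarrow> (\<forall>(i, j)\<in>triangle a b N. u * real_of_int i + v * real_of_int j \<le> B) \<longrightarrow>
       (x, y) \<in> gpath G \<longrightarrow> u * x + v * y \<le> B"
proof -
  define X where "X = nat (N div a)"
  define h where "h k = nat ((N - a * int k) div b)" for k
  have X: "k \<le> X \<longleftrightarrow> a * int k \<le> N" for k
  proof -
    have "k \<le> X \<longleftrightarrow> int k \<le> N div a"
      using assms pos_imp_zdiv_nonneg_iff[of a N] by (auto simp: X_def nat_le_iff le_nat_iff)
    then show ?thesis using assms by (simp add: int_le_div_iff algebra_simps)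
  qed
  have h: "j \<le> int (h k) \<longleftrightarrow> a * int k + b * j \<le> N" if "k \<le> X" for j k
  proof -
    have "0 \<le> (N - a * int k) div b"
      using that X assms by (simp add: pos_imp_zdiv_nonneg_iff)
    then have "j \<le> int (h k) \<longleftrightarrow> j \<le> (N - a * int k) div b" by (simp add: h_def)
    then show ?thesis using assms by (simp add: int_le_div_iff algebra_simps)
  qed
  have hT: "(int k, int (h k)) \<in> triangle a b N" if "k \<le> X" for k
    using h[OF that, of "int (h k)"] by (simp add: triangle_def)
  obtain f where f: "concave_on {0..real X} f" "f 0 = real (h 0)"
    "\<And>k. k \<le> X \<Longrightarrow> real (h k) \<le> f (real k)"
    "\<And>n. n < X \<Longrightarrow> \<exists>i j m q. i \<le> n \<and> n < j \<and> j \<le> X \<and> f (real i) = real (h i) \<and> f (real j) = real (h j) \<and>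
                  (\<forall>t\<in>{real i..real j}. f t = m * t + q)"
    using concave_hull_exists[of X "\<lambda>k. real (h k)"] by metis
  have le: "u * t + v * f t \<le> B"
    if t: "t \<in> {0..real X}" and uv: "\<And>i j. (i, j) \<in> triangle a b N \<Longrightarrow> u * real_of_int i + v * real_of_int j \<le> B"
    for u v B t
  proof -
    have k: "u * real k + v * real (h k) \<le> B" if "k \<le> X" for k
      using uv[OF hT[OF that]] by simp
    show ?thesis
    proof (cases "X = 0")
      case True
      then show ?thesis using k[of 0] t f(2) by simp
    next
      case False
      then obtain n where n: "n < X" "real n \<le> t" "t \<le> real (Suc n)"
        using real_between_nats[of t X] t by auto
      obtain i j m q where *: "i \<le> n" "n < j" "j \<le> X" "f (real i) = real (h i)" "f (real j) = real (h j)"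
        "\<forall>t\<in>{real i..real j}. f t = m * t + q" using f(4)[OF n(1)] by blast
      have "t \<in> {real i..real j}" using n * by auto
      then show ?thesis
        by (rule affine_piece_le[where m = m and q = q]) (use * k[of i] k[of j] in auto)
    qed
  qed
  have tri0: "(i, j) \<in> triangle a b N \<Longrightarrow> 0 \<le> j \<and> j \<le> int (h 0)" for i j
  proof -
    assume "(i, j) \<in> triangle a b N"
    then have *: "0 \<le> i" "0 \<le> j" "a * i + b * j \<le> N" by (auto simp: triangle_def)
    then have "b * j \<le> N" using assms by (smt (verit) mult_nonneg_nonneg)
    then show ?thesis using * h[of 0 j] by simp
  qed
  \<comment> \<open>Both bounds are instances of \<open>le\<close>, for the functionals
    \<open>- y\<close> and \<open>y\<close>.\<close>
  have bnd: "0 \<le> f t \<and> f t \<le> real (h 0)" if "t \<in> {0..real X}" for t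
    using le[OF that, of 0 "- 1" 0] le[OF that, of 0 1 "real (h 0)"] tri0 by fastforce
  have path: "convex_integral_path (graph_path X f)"
  proof (rule convex_integral_path_graph[OF f(1,2) bnd])
    fix n assume "n < X"
    from f(4)[OF this] obtain i j m q where *: "i \<le> n" "n < j" "j \<le> X" "f (real i) = real (h i)" "f (real j) = real (h j)"
        "\<forall>t\<in>{real i..real j}. f t = m * t + q" by blast
    then show "\<exists>i j m q. i \<le> n \<and> n < j \<and> j \<le> X \<and> f (real i) \<in> \<int> \<and> f (real j) \<in> \<int> \<and>
                  (\<forall>t\<in>{real i..real j}. f t = m * t + q)"
      by (metis Ints_of_nat)
  qed
  define G where "G = \<lparr>gpath = graph_path X f, hedges = {}\<rparr>"
  show ?thesis
  proof (rule that[of G])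
    show "convex_generator G" using path by (simp add: G_def convex_generator_def)
    show "hedges G = {}" by (simp add: G_def)
    have "0 \<le> i \<and> i \<le> int X \<and> 0 \<le> j \<and> real_of_int j \<le> f (real_of_int i) \<longleftrightarrow> (i, j) \<in> triangle a b N" for i j
    proof (cases "0 \<le> i \<and> i \<le> int X \<and> 0 \<le> j")
      case True
      then obtain k where k: "i = int k" "k \<le> X" by (metis nonneg_int_cases of_nat_le_iff)
      have "real_of_int j \<le> f (real k)" if "a * int k + b * j \<le> N"
      proof -
        have "real_of_int j \<le> real (h k)" using h[OF k(2)] that by (metis of_int_le_iff of_int_of_nat_eq)
        then show ?thesis using f(3)[OF k(2)] by linarith
      qed
      moreover have "a * int k + b * j \<le> N" if "real_of_int j \<le> f (real k)"
      proof -
        have "real_of_int b * real_of_int j \<le> real_of_int b * f (real k)"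
          using that assms by (intro mult_left_mono) auto
        \<comment> \<open>The hull stays under the hypotenuse, because its defining weight is one of
          the linear functionals in \<open>le\<close>; hence no lattice point is added.\<close>
        moreover have "real_of_int a * real k + real_of_int b * f (real k) \<le> real_of_int N"
        proof (rule le)
          fix i j assume "(i, j) \<in> triangle a b N"
          then have "a * i + b * j \<le> N" by (simp add: triangle_def)
          then show "real_of_int a * real_of_int i + real_of_int b * real_of_int j \<le> real_of_int N"
            by (metis of_int_add of_int_le_iff of_int_mult)
        qed (use k in auto)
        ultimately have "real_of_int (a * int k + b * j) \<le> real_of_int N" by simp
        then show ?thesis by linarith
      qed
      ultimately show ?thesis using True k by (auto simp: triangle_def)
    next
      case False
      have "i \<le> int X" if "0 \<le> i" "0 \<le> j" "a * i + b * j \<le> N"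
      proof -
        have "a * i \<le> N" using that assms by (smt (verit) mult_nonneg_nonneg)
        then show ?thesis using X[of "nat i"] that by auto
      qed
      then show ?thesis using False by (auto simp: triangle_def)
    qed
    then show "lattice_set (gpath G) = triangle a b N"
      by (auto simp: G_def lattice_set_graph_path)
    show "\<forall>u v B x y. 0 \<le> v \<longrightarrow> (\<forall>(i, j)\<in>triangle a b N. u * real_of_int i + v * real_of_int j \<le> B) \<longrightarrow>
       (x, y) \<in> gpath G \<longrightarrow> u * x + v * y \<le> B"
    proof (intro allI impI)
      fix u v B x y :: real
      assume *: "0 \<le> v" "\<forall>(i, j)\<in>triangle a b N. u * real_of_int i + v * real_of_int j \<le> B"
        "(x, y) \<in> gpath G"
      have "x \<in> {0..real X}" "y \<le> f x" using *(3) bnd by (auto simp: G_def graph_path_def)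
      then have "u * x + v * f x \<le> B" "v * y \<le> v * f x"
        using le[of x u v B] * by (auto intro: mult_left_mono)
      then show "u * x + v * y \<le> B" by linarith
    qed
  qed
qed

text \<open>In \<open>triangle a b N\<close> the abscissas range over \<open>0..N\<close>, so after
  multiplying the weight by \<open>N + 2\<close> the term \<open>\<epsilon> * i\<close> separates
  points of equal weight and never reverses a strict inequality. The tilted weight is thus
  injective, and each of its initial segments is cut out by one linear inequality, that is, it is
  the lattice of a tilted triangle.\<close>

lemma tilted_triangle:
  fixes a b N \<epsilon> :: int
  assumes ab: "0 < a" "0 < b" and N: "0 \<le> N" and \<epsilon>: "\<epsilon> = 1 \<or> \<epsilon> = - 1"
    and k: "0 < k" "k \<le> card (triangle a b N)"
  obtains \<theta> where "0 \<le> \<theta>" "card (triangle ((N + 2) * a + \<epsilon>) ((N + 2) * b) \<theta>) = k"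
    "triangle ((N + 2) * a + \<epsilon>) ((N + 2) * b) \<theta> \<subseteq> triangle a b N"
proof -
  define W where "W = (\<lambda>(i, j). ((N + 2) * a + \<epsilon>) * i + (N + 2) * b * j)"
  have W: "W (i, j) = (N + 2) * (a * i + b * j) + \<epsilon> * i" for i j
    by (simp add: W_def algebra_simps)
  have inj: "inj_on W (triangle a b N)"
  proof (rule inj_onI, clarify)
    fix i j i' j'
    assume T: "(i, j) \<in> triangle a b N" "(i', j') \<in> triangle a b N" and eq: "W (i, j) = W (i', j')"
    have r: "0 \<le> i" "i \<le> N" "0 \<le> i'" "i' \<le> N"
      using T triangle_le(1)[OF T(1) ab] triangle_le(1)[OF T(2) ab] by (simp_all add: triangle_def)
    define d where "d = (a * i + b * j) - (a * i' + b * j')"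
    have e: "(N + 2) * d = \<epsilon> * (i' - i)" using eq unfolding W d_def by (simp add: algebra_simps)
    have "d = 0"
    proof (rule ccontr)
      assume "d \<noteq> 0"
      then have "(N + 2) * 1 \<le> (N + 2) * \<bar>d\<bar>" using N by (intro mult_left_mono) auto
      also have "\<dots> = \<bar>\<epsilon> * (i' - i)\<bar>" using N by (simp add: abs_mult flip: e)
      also have "\<dots> \<le> N" using \<epsilon> r by (auto simp: abs_mult)
      finally show False by simp
    qed
    then have "i = i'" using e \<epsilon> by auto
    then show "i = i' \<and> j = j'" using \<open>d = 0\<close> ab by (simp add: d_def)
  qed
  obtain q where q: "q \<in> triangle a b N" "card {r \<in> triangle a b N. W r \<le> W q} = k"
    using card_initial_segment[OF finite_triangle[OF ab] inj k] by blast
  obtain i0 j0 where q0: "q = (i0, j0)" by force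
  have i0: "0 \<le> i0" "i0 \<le> N" "a * i0 + b * j0 \<le> N" "0 \<le> j0"
    using q(1) triangle_le(1)[OF q(1)[unfolded q0] ab] by (simp_all add: q0 triangle_def)
  have Wq: "W q \<le> (N + 2) * N + \<epsilon> * i0"
    unfolding q0 W using i0 N by (simp add: mult_left_mono)
  \<comment> \<open>Points outside the triangle must come after all points inside. The critical case
    is \<epsilon> = -1, where a point of weight \<open>w \<ge> N + 1\<close> may have abscissa up to
    \<open>w\<close>: its tilted weight is at least
    \<open>(N + 1) * w \<ge> (N + 1) * (N + 1)\<close>, which exceeds \<open>(N + 2) * N\<close> by
    just 1. A factor \<open>N + 1\<close> in place of \<open>N + 2\<close> would lose this
    strictness.\<close>
  have sub: "a * i + b * j \<le> N" if ij: "0 \<le> i" "0 \<le> j" "W (i, j) \<le> W q" for i j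
  proof (rule ccontr)
    assume "\<not> a * i + b * j \<le> N"
    then obtain w where w: "w = a * i + b * j" "w \<ge> N + 1" by simp
    have "1 * i \<le> a * i" using ij ab by (intro mult_right_mono) auto
    moreover have "0 \<le> b * j" using ij ab by simp
    ultimately have "i \<le> w" using w by simp
    have "(N + 2) * w + \<epsilon> * i \<le> (N + 2) * N + \<epsilon> * i0" using ij Wq w unfolding W by simp
    moreover have "(N + 1) * (N + 1) \<le> (N + 1) * w" "(N + 2) * (N + 1) \<le> (N + 2) * w"
      using w N by (auto intro: mult_left_mono)
    ultimately show False using \<epsilon> ij i0 \<open>i \<le> w\<close> by (auto simp: algebra_simps)
  qed
  have nonneg: "0 \<le> (N + 2) * a + \<epsilon>" 
  proof -
    have "1 * 1 \<le> (N + 2) * a" using ab N by (intro mult_mono) auto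
    then show ?thesis using \<epsilon> by auto
  qed
  have eq: "triangle ((N + 2) * a + \<epsilon>) ((N + 2) * b) (W q) = {r \<in> triangle a b N. W r \<le> W q}"
  proof (intro equalityI subsetI)
    fix r assume r: "r \<in> triangle ((N + 2) * a + \<epsilon>) ((N + 2) * b) (W q)"
    obtain i j where ij: "r = (i, j)" by force
    then have "0 \<le> i" "0 \<le> j" "W (i, j) \<le> W q" using r by (auto simp: triangle_def W_def)
    then show "r \<in> {r \<in> triangle a b N. W r \<le> W q}" using sub[of i j] ij by (simp add: triangle_def)
  next
    fix r assume "r \<in> {r \<in> triangle a b N. W r \<le> W q}"
    then show "r \<in> triangle ((N + 2) * a + \<epsilon>) ((N + 2) * b) (W q)" by (auto simp: triangle_def W_def)
  qed
  show ?thesis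
  proof (rule that[of "W q"])
    show "0 \<le> W q" using nonneg i0 N ab by (simp add: q0 W_def)
  qed (use q eq in auto)
qed

section \<open>Action estimates and the use of minimality\<close>

lemma convex_integral_path_bounded:
  assumes "convex_integral_path \<Lambda>"
  obtains X Y :: nat where "\<Lambda> \<subseteq> {0..real X} \<times> {0..real Y}" "(0, 0) \<in> lattice_set \<Lambda>"
proof -
  from assms obtain X Y :: nat and f where f: "f ` {0..real X} \<subseteq> {0..real Y}" "f 0 = real Y"
    "\<Lambda> = (\<lambda>t. (t, f t)) ` {0..real X} \<union> {real X} \<times> {0..f (real X)}"
    unfolding convex_integral_path_def by auto
  have r: "f t \<in> {0..real Y}" if "t \<in> {0..real X}" for t using f(1) that by blast
  have "f (real X) \<le> real Y" using r[of "real X"] by simp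
  then have "\<Lambda> \<subseteq> {0..real X} \<times> {0..real Y}" using r unfolding f(3) by fastforce
  moreover have "(0, real Y) \<in> \<Lambda>" using f(2) unfolding f(3) by force
  then have "(0, 0) \<in> lattice_set \<Lambda>"
    unfolding lattice_set_def enclosed_region_def using of_nat_0_le_iff[of Y] by (simp, blast)
  ultimately show ?thesis by (rule that)
qed

lemma ellipsoid_action_le:
  assumes "lattice_set (gpath G) \<noteq> {}" "\<And>x y. (x, y) \<in> gpath G \<Longrightarrow> s * x + r * y \<le> B"
  shows "ellipsoid_action r s G \<le> B"
  unfolding ellipsoid_action_def
proof (rule cSUP_least)
  obtain i j where "(i, j) \<in> lattice_set (gpath G)" using assms(1) by auto
  then show "gpath G \<noteq> {}" by (rule lattice_setE) auto
qed (use assms(2) in auto)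

lemma ellipsoid_action_ge:
  assumes "convex_generator G" "0 \<le> r" "0 \<le> s" "(i, j) \<in> lattice_set (gpath G)"
  shows "s * real_of_int i + r * real_of_int j \<le> ellipsoid_action r s G"
proof -
  obtain y where y: "real_of_int j \<le> y" "(real_of_int i, y) \<in> gpath G"
    using assms(4) by (rule lattice_setE)
  obtain X Y :: nat where XY: "gpath G \<subseteq> {0..real X} \<times> {0..real Y}"
    using assms(1) convex_integral_path_bounded unfolding convex_generator_def by metis
  have "bdd_above ((\<lambda>(x, y). s * x + r * y) ` gpath G)"
  proof (rule bdd_aboveI2[of _ _ "s * real X + r * real Y"], clarify)
    fix x y assume "(x, y) \<in> gpath G"
    then have "x \<le> real X" "y \<le> real Y" using XY by auto
    then show "s * x + r * y \<le> s * real X + r * real Y"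
      using assms by (intro add_mono mult_left_mono) auto
  qed
  from cSUP_upper[OF y(2) this] have "s * real_of_int i + r * y \<le> ellipsoid_action r s G"
    unfolding ellipsoid_action_def by simp
  moreover have "r * real_of_int j \<le> r * y" using y(1) assms by (intro mult_left_mono) auto
  ultimately show ?thesis by linarith
qed

text \<open>The only form in which the minimizing property enters. For purely elliptic generators
  the index is a function of the number of lattice points, and strict minimality makes an equally
  good competitor equal to \<open>G\<close>.\<close>

lemma minimal_generator_unique:
  assumes "minimal_for_ellipsoid r s G" "convex_generator G'" "hedges G' = {}"
    "card (lattice_set (gpath G')) = card (lattice_set (gpath G))"
    "ellipsoid_action r s G' \<le> ellipsoid_action r s G"
  shows "G' = G"
proof (rule ccontr)
  assume "G' \<noteq> G"
  moreover have "ech_index G' = ech_index G"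
    using assms by (simp add: ech_index_def lattice_count_eq minimal_for_ellipsoid_def purely_elliptic_def)
  ultimately have "ellipsoid_action r s G < ellipsoid_action r s G'"
    using assms by (auto simp: minimal_for_ellipsoid_def purely_elliptic_def)
  then show False using assms by simp
qed

text \<open>The factor \<kappa> splits off the real scale, so that points are ordered by integer
  weights. The lower bound for the action is kept in the conclusion as the benchmark for a later
  competitor with the same lattice points.\<close>

lemma minimal_lattice_set:
  fixes a b :: int and \<kappa> :: real
  assumes ab: "0 < a" "0 < b" and \<kappa>: "0 < \<kappa>"
    and min: "minimal_for_ellipsoid (\<kappa> * real_of_int b) (\<kappa> * real_of_int a) G"
  obtains N where "0 \<le> N" "lattice_set (gpath G) = triangle a b N"
    "\<kappa> * real_of_int N \<le> ellipsoid_action (\<kappa> * real_of_int b) (\<kappa> * real_of_int a) G"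
proof -
  let ?r = "\<kappa> * real_of_int b" and ?s = "\<kappa> * real_of_int a"
  define S where "S = lattice_set (gpath G)"
  define w where "w = (\<lambda>(i, j). a * i + b * j)"
  have conv: "convex_generator G" using min by (simp add: minimal_for_ellipsoid_def)
  then obtain X Y :: nat where XY: "gpath G \<subseteq> {0..real X} \<times> {0..real Y}" and S0: "(0, 0) \<in> S"
    unfolding S_def using convex_integral_path_bounded unfolding convex_generator_def by metis
  have Spos: "0 \<le> i \<and> 0 \<le> j" if "(i, j) \<in> S" for i j
    using that unfolding S_def by (rule lattice_setE) simp
  have "i \<le> int X \<and> j \<le> int Y" if ij: "(i, j) \<in> S" for i j
  proof -
    obtain y where y: "real_of_int j \<le> y" "(real_of_int i, y) \<in> gpath G"
      using ij unfolding S_def by (rule lattice_setE)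
    then have "real_of_int i \<le> real X" "y \<le> real Y" using XY by auto
    then show ?thesis using y by linarith
  qed
  then have "S \<subseteq> {0..int X} \<times> {0..int Y}" using Spos by auto
  then have fin: "finite S" by (rule finite_subset) simp
  define N where "N = Max (w ` S)"
  have "N \<in> w ` S" unfolding N_def using fin S0 by (intro Max_in) auto
  then obtain i0 j0 where ij0: "(i0, j0) \<in> S" "a * i0 + b * j0 = N" by (force simp: w_def)
  have le: "a * i + b * j \<le> N" if "(i, j) \<in> S" for i j
  proof -
    have "w (i, j) \<le> N" unfolding N_def using fin that by (intro Max_ge) auto
    then show ?thesis by (simp add: w_def)
  qed
  have N: "0 \<le> N" using le[OF S0] by simp
  have ST: "S \<subseteq> triangle a b N" using Spos le by (auto simp: triangle_def)
  have act: "\<kappa> * real_of_int N \<le> ellipsoid_action ?r ?s G"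
  proof -
    have "\<kappa> * real_of_int N = ?s * real_of_int i0 + ?r * real_of_int j0"
      by (simp add: algebra_simps flip: ij0(2))
    also have "\<dots> \<le> ellipsoid_action ?r ?s G"
      using conv \<kappa> ab ij0 unfolding S_def by (intro ellipsoid_action_ge) auto
    finally show ?thesis .
  qed
  have tri: "\<exists>\<theta>. S = triangle ((N + 2) * a + \<epsilon>) ((N + 2) * b) \<theta>" if \<epsilon>: "\<epsilon> = 1 \<or> \<epsilon> = - 1" for \<epsilon>
  proof -
    have "0 < card S" "card S \<le> card (triangle a b N)"
      using fin S0 card_mono[OF finite_triangle[OF ab] ST] by (auto simp: card_gt_0_iff)
    then obtain \<theta> where \<theta>: "0 \<le> \<theta>" "card (triangle ((N + 2) * a + \<epsilon>) ((N + 2) * b) \<theta>) = card S"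
      "triangle ((N + 2) * a + \<epsilon>) ((N + 2) * b) \<theta> \<subseteq> triangle a b N"
      using tilted_triangle[OF ab N \<epsilon>] by metis
    have "2 * 1 \<le> (N + 2) * a" using ab N by (intro mult_mono) auto
    then have "0 < (N + 2) * a + \<epsilon>" using \<epsilon> by auto
    moreover have "0 < (N + 2) * b" using ab N by simp
    ultimately obtain G' where G': "convex_generator G'" "hedges G' = {}"
      "lattice_set (gpath G') = triangle ((N + 2) * a + \<epsilon>) ((N + 2) * b) \<theta>"
      "\<forall>u v B x y. 0 \<le> v \<longrightarrow> (\<forall>(i, j)\<in>triangle ((N + 2) * a + \<epsilon>) ((N + 2) * b) \<theta>.
          u * real_of_int i + v * real_of_int j \<le> B) \<longrightarrow> (x, y) \<in> gpath G' \<longrightarrow> u * x + v * y \<le> B"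
      using triangle_generator[OF _ _ \<theta>(1)] by metis
    \<comment> \<open>The action uses the untilted weight. All lattice points of \<open>G'\<close>
      lie in \<open>triangle a b N\<close>, so this weight is at most \<open>N\<close> on them and,
      by the last property of \<open>G'\<close>, on its whole path.\<close>
    have "ellipsoid_action ?r ?s G' \<le> \<kappa> * real_of_int N"
    proof (rule ellipsoid_action_le)
      have "(0, 0) \<in> lattice_set (gpath G')" unfolding G'(3) using \<theta>(1) by (simp add: triangle_def)
      then show "lattice_set (gpath G') \<noteq> {}" by blast
      have "?s * real_of_int i + ?r * real_of_int j \<le> \<kappa> * real_of_int N"
        if "(i, j) \<in> triangle ((N + 2) * a + \<epsilon>) ((N + 2) * b) \<theta>" for i j
      proof -
        have "(i, j) \<in> triangle a b N" using that \<theta>(3) by blast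
        then have "a * i + b * j \<le> N" by (simp add: triangle_def)
        then have "\<kappa> * real_of_int (a * i + b * j) \<le> \<kappa> * real_of_int N"
          using \<kappa> by (intro mult_left_mono) linarith+
        then show ?thesis by (simp add: algebra_simps)
      qed
      moreover have "0 \<le> ?r" using \<kappa> ab by simp
      ultimately show "?s * x + ?r * y \<le> \<kappa> * real_of_int N" if "(x, y) \<in> gpath G'" for x y
        using G'(4) that by blast
    qed
    then have "G' = G"
      using act G'(1-3) \<theta>(2) by (intro minimal_generator_unique[OF min]) (simp_all add: S_def)
    then show ?thesis using G'(3) by (auto simp: S_def)
  qed
  obtain \<theta> \<theta>' where eq: "S = triangle ((N + 2) * a + 1) ((N + 2) * b) \<theta>"
    "S = triangle ((N + 2) * a + - 1) ((N + 2) * b) \<theta>'"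
    using tri[of 1] tri[of "- 1"] by auto
  \<comment> \<open>A missed point exceeds both thresholds while \<open>(i0, j0)\<close> respects
    them, yet its untilted weight is no larger. So the excess comes from the tilt alone, in both
    directions at once.\<close>
  have "triangle a b N \<subseteq> S"
  proof (rule subsetI, rule ccontr)
    fix q assume q: "q \<in> triangle a b N" "q \<notin> S"
    obtain i j where ij: "q = (i, j)" by force
    have pos: "0 \<le> i" "0 \<le> j" "a * i + b * j \<le> N" using q ij by (auto simp: triangle_def)
    have "(N + 2) * (a * i + b * j) \<le> (N + 2) * (a * i0 + b * j0)"
      using pos N ij0 by (intro mult_left_mono) auto
    then have l: "(N + 2) * a * i + (N + 2) * b * j \<le> (N + 2) * a * i0 + (N + 2) * b * j0"
      by (simp add: algebra_simps)
    have "((N + 2) * a + 1) * i0 + (N + 2) * b * j0 \<le> \<theta>" using ij0(1) unfolding eq(1) by (simp add: triangle_def)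
    moreover have "((N + 2) * a + 1) * i + (N + 2) * b * j > \<theta>"
      using q(2) pos unfolding eq(1) ij by (simp add: triangle_def)
    ultimately have "i0 < i" using l by (simp add: distrib_right)
    have "((N + 2) * a + - 1) * i0 + (N + 2) * b * j0 \<le> \<theta>'" using ij0(1) unfolding eq(2) by (simp add: triangle_def)
    moreover have "((N + 2) * a + - 1) * i + (N + 2) * b * j > \<theta>'"
      using q(2) pos unfolding eq(2) ij by (simp add: triangle_def)
    ultimately have "i < i0" using l by (simp add: left_diff_distrib)
    with \<open>i0 < i\<close> show False by simp
  qed
  then have "S = triangle a b N" using ST by blast
  with N act show ?thesis by (intro that) (auto simp: S_def)
qed

section \<open>The edges of a lattice polygon\<close>

text \<open>
  Edges of length zero are allowed, so that absent factors of the formal product need no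
  case distinction; their slopes still have to fit into the decreasing sequence.
\<close>

lemma path_verticesD:
  "v \<in> path_vertices \<Lambda> \<Longrightarrow> closed_segment P Q \<subseteq> \<Lambda> \<Longrightarrow> v \<notin> open_segment P Q"
  unfolding path_vertices_def by blast

locale lattice_polygon =
  fixes n :: nat and x y :: "nat \<Rightarrow> nat" and s :: "nat \<Rightarrow> real"
  assumes n_pos: "0 < n"
    and x_0: "x 0 = 0"
    and x_step: "a < n \<Longrightarrow> x a \<le> x (Suc a)"
    and y_step: "a < n \<Longrightarrow> real (y (Suc a)) = real (y a) + s a * (real (x (Suc a)) - real (x a))"
    and slopes: "a < b \<Longrightarrow> b < n \<Longrightarrow> s b < s a"
    and s_0: "s 0 \<le> 0"
    and y_n: "y n = 0"
begin

definition vertex :: "nat \<Rightarrow> real \<times> real" where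
  "vertex a = (real (x a), real (y a))"

text \<open>The \<open>a\<close>-th line is the one through \<open>vertex a\<close> with slope
  \<open>s a\<close>, which contains the \<open>a\<close>-th edge. For an edge of length zero it is
  just a supporting line at the vertex.\<close>

definition height :: "real \<Rightarrow> real" where
  "height = envelope n s (\<lambda>a. real (y a) - s a * real (x a))"

lemma x_mono: "a \<le> b \<Longrightarrow> b \<le> n \<Longrightarrow> x a \<le> x b"
proof (induction b rule: dec_induct)
  case (step b)
  then show ?case using x_step[of b] by simp
qed simp

lemma slope_le: "a \<le> b \<Longrightarrow> b < n \<Longrightarrow> s b \<le> s a"
  using slopes[of a b] by (cases "a = b") auto

text \<open>Slopes decrease along the polygon, so in both directions away from edge \<open>a\<close>
  it bends down from the line of that edge; hence one induction for each side.\<close>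

lemma vertex_below:
  assumes "a < n" "c \<le> n"
  shows "real (y c) \<le> s a * real (x c) + (real (y a) - s a * real (x a))"
proof (cases "a \<le> c")
  case True
  then show ?thesis using assms(2)
  proof (induction c rule: dec_induct)
    case (step c)
    have "s c * (real (x (Suc c)) - real (x c)) \<le> s a * (real (x (Suc c)) - real (x c))"
      using slope_le[of a c] x_step[of c] step by (intro mult_right_mono) auto
    then show ?case using step y_step[of c] by (simp add: algebra_simps)
  qed simp
next
  case False
  then have "c \<le> a" by simp
  then show ?thesis
  proof (induction c rule: inc_induct)
    case (step c)
    have "s a * (real (x (Suc c)) - real (x c)) \<le> s c * (real (x (Suc c)) - real (x c))"
      using slope_le[of c a] x_step[of c] step assms by (intro mult_right_mono) auto
    then show ?case using step y_step[of c] assms by (simp add: algebra_simps)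
  qed simp
qed

lemma vertex_on_line:
  assumes "a < n"
  shows "real (y (Suc a)) = s a * real (x (Suc a)) + (real (y a) - s a * real (x a))"
  using y_step[OF assms] by (simp add: algebra_simps)

lemma height_le: "a < n \<Longrightarrow> height t \<le> s a * t + (real (y a) - s a * real (x a))"
  unfolding height_def by (rule envelope_le)

lemma height_on:
  assumes "a < n" "t \<in> {real (x a)..real (x (Suc a))}"
  shows "height t = s a * t + (real (y a) - s a * real (x a))"
  unfolding height_def
proof (rule envelope_eqI[OF assms(1)])
  fix b assume "b < n"
  then show "s a * t + (real (y a) - s a * real (x a)) \<le> s b * t + (real (y b) - s b * real (x b))"
    using vertex_below[of b a] vertex_below[of b "Suc a"] vertex_on_line[OF assms(1)] assms
    by (intro line_le_lineI[OF assms(2)]) auto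
qed

lemma height_vertex:
  assumes "a \<le> n"
  shows "height (real (x a)) = real (y a)"
proof (cases "a = n")
  case True
  then show ?thesis
    using n_pos x_step[of "n - 1"] height_on[of "n - 1" "real (x n)"] vertex_on_line[of "n - 1"] by simp
next
  case False
  then show ?thesis using assms x_step[of a] height_on[of a "real (x a)"] by simp
qed

text \<open>The first vertex to the right of \<open>t\<close> ends the wanted edge. The strict bound
  on the right guarantees an edge of positive length, so degenerate edges are skipped.\<close>

lemma piece_at:
  assumes "0 \<le> t" "t < real (x n)"
  obtains a where "a < n" "real (x a) \<le> t" "t < real (x (Suc a))"
proof -
  define b where "b = (LEAST b. t < real (x b))"
  have b: "t < real (x b)" unfolding b_def by (rule LeastI) (rule assms)
  have "b \<le> n" unfolding b_def by (rule Least_le) (rule assms)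
  have "b \<noteq> 0" using b assms x_0 by (intro notI) simp
  then obtain a where a: "b = Suc a" by (cases b) auto
  have "\<not> t < real (x a)" using not_less_Least[of a "\<lambda>b. t < real (x b)"] a by (simp add: b_def)
  then show ?thesis using that[of a] a b \<open>b \<le> n\<close> by simp
qed

lemma height_bounds:
  assumes "t \<in> {0..real (x n)}"
  shows "0 \<le> height t \<and> height t \<le> real (y 0)"
proof
  have "s 0 * t \<le> 0" using s_0 assms by (simp add: mult_nonpos_nonneg)
  then show "height t \<le> real (y 0)" using height_le[OF n_pos, of t] x_0 by simp
  show "0 \<le> height t"
  proof (cases "t = real (x n)")
    case True
    then show ?thesis using height_vertex[of n] by simp
  next
    case False
    then obtain a where a: "a < n" "real (x a) \<le> t" "t < real (x (Suc a))"
      using piece_at[of t] assms by auto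
    then have t: "t \<in> {real (x a)..real (x (Suc a))}" by simp
    have "0 * t + (- 1) * height t \<le> 0"
      by (rule affine_piece_le[OF t height_on[OF a(1)]])
        (use a height_vertex[of a] height_vertex[of "Suc a"] in auto)
    then show ?thesis by simp
  qed
qed

lemma convex_integral_path_polygon: "convex_integral_path (graph_path (x n) height)"
proof (rule convex_integral_path_graph[where Y = "y 0"])
  show "concave_on {0..real (x n)} height"
    unfolding height_def using n_pos by (intro concave_on_envelope) auto
  show "height 0 = real (y 0)" using height_vertex[of 0] x_0 by simp
  show "0 \<le> height t \<and> height t \<le> real (y 0)" if "t \<in> {0..real (x n)}" for t
    using height_bounds[OF that] .
  show "\<exists>i j m q. i \<le> k \<and> k < j \<and> j \<le> x n \<and> height (real i) \<in> \<int> \<and> height (real j) \<in> \<int> \<and>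
                  (\<forall>t\<in>{real i..real j}. height t = m * t + q)" if k: "k < x n" for k
  proof -
    obtain a where a: "a < n" "x a \<le> k" "k < x (Suc a)"
      using piece_at[of "real k"] k by auto
    have "x (Suc a) \<le> x n" using x_mono[of "Suc a" n] a by simp
    moreover have "height (real (x a)) \<in> \<int>" "height (real (x (Suc a))) \<in> \<int>"
      using height_vertex[of a] height_vertex[of "Suc a"] a by simp_all
    ultimately show ?thesis using a height_on[OF a(1)] by blast
  qed
qed

lemma graph_path_polygon: "graph_path (x n) height = (\<lambda>t. (t, height t)) ` {0..real (x n)}"
  using height_vertex[of n] y_n by (auto simp: graph_path_def)

lemma vertex_in_path: "a \<le> n \<Longrightarrow> vertex a \<in> graph_path (x n) height"
  using height_vertex[of a] x_mono[of a n] by (auto simp: graph_path_polygon vertex_def image_iff)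

lemma segment_in_path:
  assumes "a < n"
  shows "closed_segment (vertex a) (vertex (Suc a)) \<subseteq> graph_path (x n) height"
    and "\<And>t. real (x a) < t \<Longrightarrow> t < real (x (Suc a)) \<Longrightarrow>
       (t, height t) \<in> open_segment (vertex a) (vertex (Suc a))"
proof -
  have v: "vertex a = (real (x a), height (real (x a)))"
    "vertex (Suc a) = (real (x (Suc a)), height (real (x (Suc a))))"
    using height_vertex[of a] height_vertex[of "Suc a"] assms by (simp_all add: vertex_def)
  have le: "real (x a) \<le> real (x (Suc a))" using x_step[OF assms] by simp
  have eq: "closed_segment (vertex a) (vertex (Suc a)) = (\<lambda>t. (t, height t)) ` {real (x a)..real (x (Suc a))}"
    unfolding v by (rule graph_in_segment(1)[OF le height_on[OF assms]])
  have "x (Suc a) \<le> x n" using x_mono[of "Suc a" n] assms by simp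
  then have "{real (x a)..real (x (Suc a))} \<subseteq> {0..real (x n)}" by auto
  then show "closed_segment (vertex a) (vertex (Suc a)) \<subseteq> graph_path (x n) height"
    unfolding eq graph_path_polygon by (rule image_mono)
  show "(t, height t) \<in> open_segment (vertex a) (vertex (Suc a))"
    if "real (x a) < t" "t < real (x (Suc a))" for t
    unfolding v by (rule graph_in_segment(2)[OF le height_on[OF assms] that])
qed

lemma path_point:
  assumes "(t, z) \<in> graph_path (x n) height"
  shows "0 \<le> t" "t \<le> real (x n)" "z = height t"
  using assms by (auto simp: graph_path_polygon)

text \<open>
  At an interior vertex two supporting lines of different slopes meet; a segment of the path
  through the vertex would have to lie on both of them.
\<close>

lemma vertex_is_path_vertex:
  assumes "c \<le> n"
  shows "vertex c \<in> path_vertices (graph_path (x n) height)"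
  unfolding path_vertices_def
proof (intro CollectI conjI notI)
  show "vertex c \<in> graph_path (x n) height" by (rule vertex_in_path[OF assms])
  assume "\<exists>P Q. closed_segment P Q \<subseteq> graph_path (x n) height \<and> vertex c \<in> open_segment P Q"
  then obtain P Q where PQ: "closed_segment P Q \<subseteq> graph_path (x n) height" "vertex c \<in> open_segment P Q"
    by blast
  obtain p1 p2 q1 q2 where P: "P = (p1, p2)" and Q: "Q = (q1, q2)" by fastforce
  have "(p1, p2) \<in> graph_path (x n) height" "(q1, q2) \<in> graph_path (x n) height"
    using PQ(1) P Q by auto
  note Pp = path_point[OF this(1)] and Qp = path_point[OF this(2)]
  from PQ(2) obtain u where u: "P \<noteq> Q" "0 < u" "u < 1"
    "real (x c) = (1 - u) * p1 + u * q1" "real (y c) = (1 - u) * p2 + u * q2"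
    by (auto simp: in_segment P Q vertex_def)
  \<comment> \<open>A proper convex combination of numbers bounded by \<open>r\<close> reaches
    \<open>r\<close> only if both numbers equal \<open>r\<close>. This is applied to abscissas at
    the two extremes of the path, and to supporting lines in between.\<close>
  have tight: "p = r \<and> q = r"
    if "p \<le> r" "q \<le> r" "(1 - u) * p + u * q = r" for p q r :: real
  proof -
    have "0 \<le> (1 - u) * (r - p)" "0 \<le> u * (r - q)" using that u by simp_all
    moreover have "(1 - u) * (r - p) + u * (r - q) = 0" using that(3) by (simp add: algebra_simps)
    ultimately have "(1 - u) * (r - p) = 0" "u * (r - q) = 0" by linarith+
    then show ?thesis using u by simp
  qed
  have "p1 = real (x c) \<and> q1 = real (x c)"
  proof -
    consider "x c = 0" | "x c = x n" | "0 < x c" "x c < x n" using x_mono[OF assms] by linarith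
    then show ?thesis
    proof cases
      case 1
      then show ?thesis using tight[of "- p1" 0 "- q1"] Pp Qp u(4) by (simp add: algebra_simps)
    next
      case 2
      then show ?thesis using tight[of p1 "real (x c)" q1] Pp Qp u(4) by simp
    next
      case 3
      \<comment> \<open>Edge \<open>a\<close> arrives at the abscissa of the vertex from the left,
        while \<open>b\<close> below leaves it to the right. Degenerate edges may sit between them,
        so \<open>b\<close> need not be \<open>Suc a\<close>; only \<open>a < b\<close> is used, for
        the strict inequality of slopes.\<close>
      obtain a where a: "a < n" "x a < x c" "x c \<le> x (Suc a)"
      proof -
        define b where "b = (LEAST b. x c \<le> x b)"
        have b: "x c \<le> x b" unfolding b_def by (rule LeastI[of _ c]) simp
        have "b \<le> c" unfolding b_def by (rule Least_le) simp
        have "b \<noteq> 0" using b 3 x_0 by (intro notI) simp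
        then obtain a where a: "b = Suc a" by (cases b) auto
        have "\<not> x c \<le> x a" using not_less_Least[of a "\<lambda>b. x c \<le> x b"] a by (simp add: b_def)
        then show ?thesis using that[of a] a b \<open>b \<le> c\<close> assms by simp
      qed
      obtain b where b: "b < n" "x b \<le> x c" "x c < x (Suc b)"
        using piece_at[of "real (x c)"] 3 by auto
      have ac: "Suc a \<le> c"
        using x_mono[of c a] a by (cases "Suc a \<le> c") auto
      have cb: "c \<le> b"
        using x_mono[of "Suc b" c] b assms by (cases "c \<le> b") auto
      then have s: "s b < s a" using slopes[of a b] b ac cb by simp
      have on: "real (y c) = s e * real (x c) + (real (y e) - s e * real (x e))" if "e = a \<or> e = b" for e
        using that a b height_on[of a "real (x c)"] height_on[of b "real (x c)"] height_vertex[OF assms]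
        by auto
      have line: "p2 = s e * p1 + (real (y e) - s e * real (x e)) \<and> q2 = s e * q1 + (real (y e) - s e * real (x e))"
        if "e = a \<or> e = b" for e
      proof -
        have "e < n" using that a b by auto
        have "p2 - s e * p1 \<le> real (y e) - s e * real (x e)" "q2 - s e * q1 \<le> real (y e) - s e * real (x e)"
          using height_le[OF \<open>e < n\<close>, of p1] height_le[OF \<open>e < n\<close>, of q1] Pp Qp by simp_all
        moreover have "(1 - u) * (p2 - s e * p1) + u * (q2 - s e * q1) = real (y e) - s e * real (x e)"
          using on[OF that] unfolding u by (simp add: algebra_simps)
        ultimately have "p2 - s e * p1 = real (y e) - s e * real (x e) \<and> q2 - s e * q1 = real (y e) - s e * real (x e)"
          by (rule tight)
        then show ?thesis by linarith
      qed
      have eq: "t = real (x c)"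
        if "z = s a * t + (real (y a) - s a * real (x a))" "z = s b * t + (real (y b) - s b * real (x b))" for t z
      proof -
        have "(s a - s b) * (t - real (x c)) = 0"
          using that on[of a] on[of b] by (simp add: algebra_simps)
        then show ?thesis using s by simp
      qed
      show ?thesis using line[of a] line[of b] eq by blast
    qed
  qed
  \<comment> \<open>The path is the graph of \<open>height\<close>, so ends with equal abscissas
    coincide.\<close>
  then have "P = Q" using Pp Qp P Q by simp
  then show False using u by simp
qed

lemma path_vertices_polygon: "path_vertices (graph_path (x n) height) = vertex ` {..n}"
proof (intro equalityI subsetI)
  fix v assume v: "v \<in> path_vertices (graph_path (x n) height)"
  obtain t z where tz: "v = (t, z)" by force
  then have mem: "(t, z) \<in> graph_path (x n) height" using v by (simp add: path_vertices_def)
  note t = path_point[OF mem]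
  show "v \<in> vertex ` {..n}"
  proof (cases "t = real (x n)")
    case True
    then have "v = vertex n" using height_vertex[of n] t tz by (simp add: vertex_def)
    then show ?thesis by blast
  next
    case False
    then obtain a where a: "a < n" "real (x a) \<le> t" "t < real (x (Suc a))"
      using piece_at[of t] t by auto
    have "(t, height t) \<notin> open_segment (vertex a) (vertex (Suc a))"
      using path_verticesD[OF v segment_in_path(1)[OF a(1)]] tz t(3) by simp
    then have "\<not> real (x a) < t" using segment_in_path(2)[OF a(1)] a(3) by blast
    then have "v = vertex a" using a height_vertex[of a] t tz by (simp add: vertex_def)
    then show ?thesis using a by auto
  qed
qed (use vertex_is_path_vertex in auto)

text \<open>An edge of the path starts over some \<open>x c\<close>, and \<open>piece_at\<close>
  supplies the nondegenerate edge \<open>a\<close> leaving from there. Degenerate edges may separate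
  \<open>c\<close> from \<open>a\<close>, so vertices are matched by abscissa and not by index. If
  the path edge went beyond \<open>vertex (Suc a)\<close>, this vertex would lie strictly inside a
  segment of the path.\<close>

lemma path_edges_polygon:
  "path_edges (graph_path (x n) height) =
     (\<lambda>a. (vertex a, vertex (Suc a))) ` {a. a < n \<and> x a < x (Suc a)}"
proof (intro equalityI subsetI)
  fix e assume "e \<in> path_edges (graph_path (x n) height)"
  then obtain v w where e: "e = (v, w)" and vw: "v \<in> vertex ` {..n}" "w \<in> vertex ` {..n}" "v \<noteq> w"
    "fst v \<le> fst w" and seg: "closed_segment v w \<subseteq> graph_path (x n) height"
    unfolding path_edges_def path_vertices_polygon by blast
  then obtain c d where c: "v = vertex c" "c \<le> n" and d: "w = vertex d" "d \<le> n" by auto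
  have "x c \<noteq> x d" using vw(3) height_vertex[OF c(2)] height_vertex[OF d(2)] c d by (auto simp: vertex_def)
  then have "x c < x d" using vw(4) c d by (simp add: vertex_def)
  then have "x c < x n" using x_mono[of d n] d by simp
  then obtain a where a: "a < n" "x a \<le> x c" "x c < x (Suc a)"
    using piece_at[of "real (x c)"] by auto
  have "c \<le> a"
  proof (rule ccontr)
    assume "\<not> c \<le> a"
    then show False using x_mono[of "Suc a" c] a c by simp
  qed
  then have xa: "x a = x c" using x_mono[of c a] a by simp
  have "a < d"
  proof (rule ccontr)
    assume "\<not> a < d"
    then show False using x_mono[of d a] a \<open>x c < x d\<close> by simp
  qed
  then have "x (Suc a) \<le> x d" using x_mono[of "Suc a" d] d by simp
  moreover have "\<not> x (Suc a) < x d"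
  proof
    assume lt: "x (Suc a) < x d"
    define u where "u = (real (x (Suc a)) - real (x c)) / (real (x d) - real (x c))"
    have u: "0 < u" "u < 1" "(1 - u) * real (x c) + u * real (x d) = real (x (Suc a))"
    proof -
      have "u * (real (x d) - real (x c)) = real (x (Suc a)) - real (x c)"
        using \<open>x c < x d\<close> by (simp add: u_def)
      then show "(1 - u) * real (x c) + u * real (x d) = real (x (Suc a))"
        by (simp add: algebra_simps)
    qed (use a lt in \<open>simp_all add: u_def\<close>)
    let ?r = "(1 - u) *\<^sub>R v + u *\<^sub>R w"
    have "?r \<in> open_segment v w" using u vw(3) by (auto simp: in_segment)
    moreover have "?r = vertex (Suc a)"
    proof -
      have "?r \<in> graph_path (x n) height" using seg \<open>?r \<in> open_segment v w\<close> open_closed_segment by blast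
      moreover have "?r = (real (x (Suc a)), snd ?r)" using u(3) c d by (simp add: vertex_def)
      ultimately have "snd ?r = height (real (x (Suc a)))" using path_point(3) by metis
      then show ?thesis using \<open>?r = (real (x (Suc a)), snd ?r)\<close> height_vertex[of "Suc a"] a
        by (simp add: vertex_def)
    qed
    ultimately show False
      using path_verticesD[OF vertex_is_path_vertex[of "Suc a"] seg] a by simp
  qed
  ultimately have xd: "x (Suc a) = x d" by simp
  have "v = vertex a" "w = vertex (Suc a)"
    using xa xd height_vertex[of a] height_vertex[of "Suc a"] height_vertex[of c] height_vertex[of d] a c d
    by (simp_all add: vertex_def)
  then show "e \<in> (\<lambda>a. (vertex a, vertex (Suc a))) ` {a. a < n \<and> x a < x (Suc a)}"
    using e a xa by auto
next
  fix e assume "e \<in> (\<lambda>a. (vertex a, vertex (Suc a))) ` {a. a < n \<and> x a < x (Suc a)}"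
  then obtain a where a: "a < n" "x a < x (Suc a)" "e = (vertex a, vertex (Suc a))" by auto
  have "s a \<le> 0" using slope_le[of 0 a] s_0 a by simp
  then have "s a * (real (x (Suc a)) - real (x a)) \<le> 0" using a by (simp add: mult_nonpos_nonneg)
  then have "y (Suc a) \<le> y a" using y_step[OF a(1)] by simp
  then show "e \<in> path_edges (graph_path (x n) height)"
    using a segment_in_path(1)[OF a(1)]
    by (auto simp: path_edges_def path_vertices_polygon vertex_def)
qed

text \<open>The sum runs over all indices, so the number of factors is fixed whichever exponents
  vanish: \<open>gcd 0 0 = 0\<close> makes the symbol of a degenerate edge empty.\<close>

lemma formal_product_polygon:
  assumes "gpath G = graph_path (x n) height"
  shows "formal_product G = (\<Sum>a<n. edge_symbol (vertex a, vertex (Suc a)))"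
proof -
  let ?A = "{a. a < n \<and> x a < x (Suc a)}"
  have inj: "inj_on (\<lambda>a. (vertex a, vertex (Suc a))) ?A"
  proof (rule inj_onI)
    fix a b assume ab: "a \<in> ?A" "b \<in> ?A" "(vertex a, vertex (Suc a)) = (vertex b, vertex (Suc b))"
    then have "x a = x b" "x (Suc a) = x (Suc b)" by (simp_all add: vertex_def)
    then show "a = b"
      using x_mono[of "Suc a" b] x_mono[of "Suc b" a] ab(1,2) by (cases a b rule: linorder_cases) auto
  qed
  have triv: "edge_symbol (vertex a, vertex (Suc a)) = {#}" if "a < n" "\<not> x a < x (Suc a)" for a
  proof -
    have "x (Suc a) = x a" using x_step[of a] that by simp
    moreover have "y (Suc a) = y a" using y_step[of a] that calculation by simp
    ultimately show ?thesis by (simp add: edge_symbol_def vertex_def)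
  qed
  have "formal_product G = (\<Sum>a\<in>?A. edge_symbol (vertex a, vertex (Suc a)))"
    unfolding formal_product_def assms path_edges_polygon sum.reindex[OF inj] by simp
  also have "\<dots> = (\<Sum>a<n. edge_symbol (vertex a, vertex (Suc a)))"
    using triv by (intro sum.mono_neutral_left) auto
  finally show ?thesis .
qed

end

section \<open>The hull of the triangle\<close>

lemma edge_symbol_multiple:
  assumes "coprime r t"
  shows "edge_symbol ((real a, real (b + m * t)), (real (a + m * r), real b)) = replicate_mset m (r, t)"
proof -
  have "gcd (m * r) (m * t) = m"
    using assms by (simp add: gcd_mult_distrib_nat[symmetric])
  moreover have "nat \<lfloor>real (a + m * r) - real a\<rfloor> = m * r" "nat \<lfloor>real (b + m * t) - real b\<rfloor> = m * t"
    by (simp_all flip: of_nat_mult)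
  ultimately show ?thesis by (cases "m = 0") (simp_all add: edge_symbol_def)
qed

text \<open>Here \<open>2 * q + 1\<close> plays the role of p. The direction
  \<open>(2 * q + 1, 2)\<close> of the hypotenuse is the sum of its neighbours
  \<open>(q + 1, 1)\<close> and \<open>(q, 1)\<close>, which puts the slopes in decreasing order.
  Each inequality for the lattice points is the half-plane under the line of one edge, with
  denominators cleared. The third has the weight of the ellipsoid as its left side, so its right
  side bounds the action; this persists for \<open>d = 0\<close>, when the line only supports the
  polygon at a vertex.\<close>

lemma four_edge_generator:
  fixes q k m1 d m2 :: nat
  assumes "0 < q"
  obtains G where "convex_generator G" "hedges G = {}"
    "formal_product G = replicate_mset k (1, 0) + replicate_mset m1 (q + 1, 1) +
       replicate_mset d (2 * q + 1, 2) + replicate_mset m2 (q, 1)"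
    "lattice_set (gpath G) = {(i, j). 0 \<le> i \<and> 0 \<le> j \<and> j \<le> int (m1 + 2 * d + m2) \<and>
       i + int (q + 1) * j \<le> int (k + (q + 1) * (m1 + 2 * d + m2)) \<and>
       2 * i + int (2 * q + 1) * j \<le> int (2 * k + 2 * (q + 1) * m1 + (2 * q + 1) * (2 * d + m2)) \<and>
       i + int q * j \<le> int (k + (q + 1) * m1 + (2 * q + 1) * d + q * m2)}"
    "\<forall>(x, y)\<in>gpath G.
       2 * x + real (2 * q + 1) * y \<le> real (2 * k + 2 * (q + 1) * m1 + (2 * q + 1) * (2 * d + m2))"
proof -
  define x where "x = (!) [0, k, k + m1 * (q + 1), k + m1 * (q + 1) + d * (2 * q + 1),
    k + m1 * (q + 1) + d * (2 * q + 1) + m2 * q]"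
  define y where "y = (!) [m2 + d * 2 + m1 * 1, m2 + d * 2 + m1 * 1, m2 + d * 2, m2, 0]"
  define s where "s = (!) [0, - 1 / real (q + 1), - 2 / real (2 * q + 1), - 1 / real q]"
  have lt4: "a < 4 \<longleftrightarrow> a = 0 \<or> a = Suc 0 \<or> a = 2 \<or> a = 3" for a :: nat by auto
  have xs: "x 0 = 0" "x (Suc 0) = k" "x 2 = k + m1 * (q + 1)" "x 3 = k + m1 * (q + 1) + d * (2 * q + 1)"
    "x 4 = k + m1 * (q + 1) + d * (2 * q + 1) + m2 * q"
    by (simp_all add: x_def numeral_2_eq_2 numeral_3_eq_3 eval_nat_numeral)
  \<comment> \<open>The summand 0 and the factors 1 are kept, so that consecutive vertices match
    \<open>edge_symbol_multiple\<close> literally.\<close>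
  have ys: "y 0 = 0 + m2 * 1 + d * 2 + m1 * 1" "y (Suc 0) = 0 + m2 * 1 + d * 2 + m1 * 1"
    "y 2 = 0 + m2 * 1 + d * 2" "y 3 = 0 + m2 * 1" "y 4 = 0"
    by (simp_all add: y_def numeral_2_eq_2 numeral_3_eq_3 eval_nat_numeral)
  have ss: "s 0 = 0" "s (Suc 0) = - 1 / real (q + 1)" "s 2 = - 2 / real (2 * q + 1)" "s 3 = - 1 / real q"
    by (simp_all add: s_def numeral_2_eq_2 numeral_3_eq_3 eval_nat_numeral)
  have Suc: "Suc 2 = 3" "Suc 3 = 4" "Suc (Suc 0) = 2" by simp_all
  have q: "real q > 0" using assms by simp
  interpret P: lattice_polygon 4 x y s
  proof
    show "x a \<le> x (Suc a)" if "a < 4" for a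
      using that unfolding lt4 by (auto simp: xs Suc)
    show "real (y (Suc a)) = real (y a) + s a * (real (x (Suc a)) - real (x a))" if "a < 4" for a
      using that q unfolding lt4 by (auto simp: xs ys ss Suc field_simps)
    show "s b < s a" if "a < b" "b < 4" for a b
    proof -
      have "a < 4" using that by simp
      then show ?thesis using that q unfolding lt4 by (auto simp: ss field_simps)
    qed
  qed (simp_all add: xs ys ss)
  define G where "G = \<lparr>gpath = graph_path (x 4) P.height, hedges = {}\<rparr>"
  have le: "z \<le> P.height t \<longleftrightarrow> z \<le> real (m2 + d * 2 + m1) \<and>
      t + real (q + 1) * z \<le> real (k + (q + 1) * (m1 + 2 * d + m2)) \<and>
      2 * t + real (2 * q + 1) * z \<le> real (2 * k + 2 * (q + 1) * m1 + (2 * q + 1) * (2 * d + m2)) \<and>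
      t + real q * z \<le> real (k + (q + 1) * m1 + (2 * q + 1) * d + q * m2)" (is "_ \<longleftrightarrow> ?R") for z t
  proof -
    have "z \<le> P.height t \<longleftrightarrow> (\<forall>a<4. z \<le> s a * t + (real (y a) - s a * real (x a)))"
    proof
      assume "z \<le> P.height t"
      then show "\<forall>a<4. z \<le> s a * t + (real (y a) - s a * real (x a))"
        using P.height_le order_trans by blast
    next
      assume "\<forall>a<4. z \<le> s a * t + (real (y a) - s a * real (x a))"
      then show "z \<le> P.height t" unfolding P.height_def by (intro envelope_ge) auto
    qed
    also have "\<dots> \<longleftrightarrow> z \<le> s 0 * t + (real (y 0) - s 0 * real (x 0)) \<and>
       z \<le> s (Suc 0) * t + (real (y (Suc 0)) - s (Suc 0) * real (x (Suc 0))) \<and>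
       z \<le> s 2 * t + (real (y 2) - s 2 * real (x 2)) \<and>
       z \<le> s 3 * t + (real (y 3) - s 3 * real (x 3))"
      unfolding lt4 by blast
    also have "\<dots> \<longleftrightarrow> ?R"
      unfolding xs ys ss using q
      by (intro conj_cong) (simp_all add: divide_simps, simp_all add: algebra_simps)
    finally show ?thesis .
  qed
  show ?thesis
  proof (rule that[of G])
    show "convex_generator G"
      using P.convex_integral_path_polygon by (simp add: G_def convex_generator_def)
    show "hedges G = {}" by (simp add: G_def)
    have "formal_product G = (\<Sum>a<4. edge_symbol (P.vertex a, P.vertex (Suc a)))"
      by (rule P.formal_product_polygon) (simp add: G_def)
    also have "\<dots> = edge_symbol (P.vertex 0, P.vertex (Suc 0)) + edge_symbol (P.vertex (Suc 0), P.vertex 2)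
       + edge_symbol (P.vertex 2, P.vertex 3) + edge_symbol (P.vertex 3, P.vertex 4)"
      by (simp add: eval_nat_numeral)
    also have "edge_symbol (P.vertex 0, P.vertex (Suc 0)) = replicate_mset k (1, 0)"
      using edge_symbol_multiple[of 1 0 0 "m2 + d * 2 + m1" k] by (simp add: P.vertex_def xs ys)
    also have "edge_symbol (P.vertex (Suc 0), P.vertex 2) = replicate_mset m1 (q + 1, 1)"
      unfolding P.vertex_def xs ys by (rule edge_symbol_multiple) simp
    also have "edge_symbol (P.vertex 2, P.vertex 3) = replicate_mset d (2 * q + 1, 2)"
      unfolding P.vertex_def xs ys by (rule edge_symbol_multiple) simp
    also have "edge_symbol (P.vertex 3, P.vertex 4) = replicate_mset m2 (q, 1)"
      unfolding P.vertex_def xs ys by (rule edge_symbol_multiple) simp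
    finally show "formal_product G = replicate_mset k (1, 0) + replicate_mset m1 (q + 1, 1) +
       replicate_mset d (2 * q + 1, 2) + replicate_mset m2 (q, 1)" .
    have x4: "x 4 = k + (q + 1) * m1 + (2 * q + 1) * d + q * m2" by (simp add: xs)
    show "lattice_set (gpath G) = {(i, j). 0 \<le> i \<and> 0 \<le> j \<and> j \<le> int (m1 + 2 * d + m2) \<and>
       i + int (q + 1) * j \<le> int (k + (q + 1) * (m1 + 2 * d + m2)) \<and>
       2 * i + int (2 * q + 1) * j \<le> int (2 * k + 2 * (q + 1) * m1 + (2 * q + 1) * (2 * d + m2)) \<and>
       i + int q * j \<le> int (k + (q + 1) * m1 + (2 * q + 1) * d + q * m2)}"
    proof -
      have cast: "real_of_int j \<le> real (m2 + d * 2 + m1) \<longleftrightarrow> j \<le> int (m1 + 2 * d + m2)"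
        "real_of_int i + real u * real_of_int j \<le> real v \<longleftrightarrow> i + int u * j \<le> int v"
        "2 * real_of_int i + real u * real_of_int j \<le> real v \<longleftrightarrow> 2 * i + int u * j \<le> int v" for i j u v
      proof -
        show "real_of_int j \<le> real (m2 + d * 2 + m1) \<longleftrightarrow> j \<le> int (m1 + 2 * d + m2)" by linarith
        have "real_of_int i + real u * real_of_int j = real_of_int (i + int u * j)"
          "2 * real_of_int i + real u * real_of_int j = real_of_int (2 * i + int u * j)" by simp_all
        then show "real_of_int i + real u * real_of_int j \<le> real v \<longleftrightarrow> i + int u * j \<le> int v"
          "2 * real_of_int i + real u * real_of_int j \<le> real v \<longleftrightarrow> 2 * i + int u * j \<le> int v"
          by linarith+
      qed
      \<comment> \<open>For \<open>0 \<le> j\<close> the fourth inequality already implies the bound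
        on the width.\<close>
      have "i \<le> int (x 4)" if "0 \<le> j" "i + int q * j \<le> int (k + (q + 1) * m1 + (2 * q + 1) * d + q * m2)" for i j
      proof -
        have "0 \<le> int q * j" using that by simp
        then show ?thesis using that unfolding x4 by linarith
      qed
      then show ?thesis
        unfolding G_def generator.simps lattice_set_graph_path le cast by blast
    qed
    have "2 * t + real (2 * q + 1) * z \<le> real (2 * k + 2 * (q + 1) * m1 + (2 * q + 1) * (2 * d + m2))"
      if "(t, z) \<in> gpath G" for t z
    proof -
      have "z = P.height t" using that P.path_point(3) by (simp add: G_def)
      then show ?thesis using le[of z t] by blast
    qed
    then show "\<forall>(t, z)\<in>gpath G.
       2 * t + real (2 * q + 1) * z \<le> real (2 * k + 2 * (q + 1) * m1 + (2 * q + 1) * (2 * d + m2))"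
      by blast
  qed
qed

text \<open>With p = \<open>2 * q + 1\<close>, division of \<open>N\<close> by p gives the top row
  \<open>Y\<close> and the weight \<open>r\<close> left for it; the row \<open>t\<close> steps below
  the top ends at abscissa \<open>(r + p * t) div 2\<close>. If \<open>r\<close> is even, the top
  row ends on the line of weight \<open>N\<close>; if \<open>r\<close> is odd, it ends one unit of
  weight short, and the first step down gains \<open>q + 1\<close> and reaches the line. From there
  each pair of rows gains exactly p, and a single remaining row gains only \<open>q\<close>. Since
  \<open>r \<le> 2 * q\<close>, the length \<open>k = r div 2\<close> is at most \<open>q\<close>,
  and less than \<open>q\<close> when \<open>r\<close> is odd.\<close>

lemma triangle_shape:
  fixes q :: nat and N :: int
  assumes "0 < q" "0 \<le> N"
  obtains k m1 d m2 :: nat where "m1 \<in> {0, 1}" "m2 \<in> {0, 1}" "m1 = 1 \<longrightarrow> k < q" "m1 = 0 \<longrightarrow> k < q + 1"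
    "int (2 * k + 2 * (q + 1) * m1 + (2 * q + 1) * (2 * d + m2)) \<le> N"
    "{(i, j). 0 \<le> i \<and> 0 \<le> j \<and> j \<le> int (m1 + 2 * d + m2) \<and>
       i + int (q + 1) * j \<le> int (k + (q + 1) * (m1 + 2 * d + m2)) \<and>
       2 * i + int (2 * q + 1) * j \<le> int (2 * k + 2 * (q + 1) * m1 + (2 * q + 1) * (2 * d + m2)) \<and>
       i + int q * j \<le> int (k + (q + 1) * m1 + (2 * q + 1) * d + q * m2)} = triangle 2 (int (2 * q + 1)) N"
proof -
  define Y where "Y = nat N div (2 * q + 1)"
  define r where "r = nat N mod (2 * q + 1)"
  define k where "k = r div 2"
  \<comment> \<open>The condition \<open>0 < Y\<close> covers a triangle with a single row, where no
    lower row is left to descend to. For odd \<open>r\<close> the polygon then has top weight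
    \<open>N - 1\<close>, so the weight is only bounded by \<open>N\<close>.\<close>
  define m1 where "m1 = (if odd r \<and> 0 < Y then 1 else 0 :: nat)"
  define d where "d = (Y - m1) div 2"
  define m2 where "m2 = (Y - m1) mod 2"
  have "nat N = (2 * q + 1) * Y + r" unfolding Y_def r_def by (rule mult_div_mod_eq[symmetric])
  then have N: "N = (2 * int q + 1) * int Y + int r"
    using assms by (metis (no_types, lifting) int_nat_eq of_nat_1 of_nat_add of_nat_mult of_nat_numeral)
  have r: "r < 2 * q + 1" by (simp add: r_def)
  have Y: "m1 + 2 * d + m2 = Y" by (simp add: d_def m2_def m1_def)
  have rk: "r = 2 * k \<or> r = 2 * k + 1" by (auto simp: k_def)
  have odd: "odd r \<longleftrightarrow> r = 2 * k + 1" unfolding k_def by presburger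
  have top: "int (2 * k + 2 * (q + 1) * m1 + (2 * q + 1) * (2 * d + m2)) =
      2 * int k + int m1 + (2 * int q + 1) * int Y"
    unfolding Y[symmetric] by (simp add: algebra_simps)
  have right: "2 * int (k + (q + 1) * m1 + (2 * q + 1) * d + q * m2) =
      2 * int k + int m1 + (2 * int q + 1) * int Y - int m2"
    unfolding Y[symmetric] by (simp add: algebra_simps)
  have mid: "int (k + (q + 1) * (m1 + 2 * d + m2)) = int k + (int q + 1) * int Y"
    unfolding Y by (simp add: algebra_simps)
  show ?thesis
  proof (rule that[of m1 m2 k d])
    show "m1 \<in> {0, 1}" "m2 \<in> {0, 1}" by (auto simp: m1_def m2_def)
    show "m1 = 1 \<longrightarrow> k < q" using r odd by (auto simp: m1_def split: if_splits)
    show "m1 = 0 \<longrightarrow> k < q + 1" using r rk by auto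
    show "int (2 * k + 2 * (q + 1) * m1 + (2 * q + 1) * (2 * d + m2)) \<le> N"
      unfolding top N using odd rk by (auto simp: m1_def)
    have *: "j \<le> int Y \<and> i + (int q + 1) * j \<le> int k + (int q + 1) * int Y \<and>
       2 * i + (2 * int q + 1) * j \<le> 2 * int k + int m1 + (2 * int q + 1) * int Y \<and>
       2 * (i + int q * j) \<le> 2 * int k + int m1 + (2 * int q + 1) * int Y - int m2
       \<longleftrightarrow> 2 * i + (2 * int q + 1) * j \<le> N" if ij: "0 \<le> i" "0 \<le> j" for i j
    proof
      assume *: "2 * i + (2 * int q + 1) * j \<le> N"
      have jY: "j \<le> int Y"
      proof (rule ccontr)
        assume "\<not> j \<le> int Y"
        then have "(2 * int q + 1) * (int Y + 1) \<le> (2 * int q + 1) * j" by (intro mult_left_mono) auto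
        then show False using * r ij unfolding N by (simp add: algebra_simps)
      qed
      have J: "2 * i + 2 * (int q * j) + j \<le> 2 * (int q * int Y) + int Y + int r"
        using * unfolding N by (simp add: algebra_simps)
      have "i + int q * j + j \<le> int k + int q * int Y + int Y"
        using J jY rk by linarith
      moreover have "2 * i + 2 * (int q * j) + j \<le> 2 * int k + int m1 + 2 * (int q * int Y) + int Y"
      \<comment> \<open>For \<open>Y = 0\<close> the bound is \<open>2 * k\<close> even if
        \<open>r = 2 * k + 1\<close>; the missing unit is recovered because \<open>2 * i\<close> is
        even.\<close>
      proof (cases "Y = 0")
        case True
        then have "j = 0" using jY ij by simp
        then have "2 * i \<le> int r" using J True by simp
        then have "2 * i \<le> 2 * int k" using rk by presburger
        then show ?thesis using True \<open>j = 0\<close> by simp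
      next
        case False
        then show ?thesis using J rk odd by (auto simp: m1_def)
      qed
      moreover have "2 * (i + int q * j) \<le> 2 * int k + int m1 + 2 * (int q * int Y) + int Y - int m2"
      proof -
        \<comment> \<open>\<open>m2\<close> is the parity of \<open>m1 + Y\<close>, hence of the
          bound just proved. The quantity \<open>2 * (i + q * j)\<close> is even, so it cannot
          attain an odd bound, and \<open>m2\<close> may be subtracted.\<close>
        have "even (int m1 + int Y - int m2)" using Y by presburger
        then obtain e where e: "int m1 + int Y - int m2 = 2 * e" by blast
        have "int m2 \<le> 1" by (simp add: m2_def)
        then show ?thesis
          using \<open>2 * i + 2 * (int q * j) + j \<le> 2 * int k + int m1 + 2 * (int q * int Y) + int Y\<close> e ij
          by presburger
      qed
      ultimately show "j \<le> int Y \<and> i + (int q + 1) * j \<le> int k + (int q + 1) * int Y \<and>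
       2 * i + (2 * int q + 1) * j \<le> 2 * int k + int m1 + (2 * int q + 1) * int Y \<and>
       2 * (i + int q * j) \<le> 2 * int k + int m1 + (2 * int q + 1) * int Y - int m2"
        using jY by (simp add: algebra_simps)
    next
      assume "j \<le> int Y \<and> i + (int q + 1) * j \<le> int k + (int q + 1) * int Y \<and>
       2 * i + (2 * int q + 1) * j \<le> 2 * int k + int m1 + (2 * int q + 1) * int Y \<and>
       2 * (i + int q * j) \<le> 2 * int k + int m1 + (2 * int q + 1) * int Y - int m2"
      moreover have "2 * int k + int m1 \<le> int r" using odd rk by (auto simp: m1_def)
      ultimately show "2 * i + (2 * int q + 1) * j \<le> N" unfolding N by linarith
    qed
    have char: "j \<le> int (m1 + 2 * d + m2) \<and>
       i + int (q + 1) * j \<le> int (k + (q + 1) * (m1 + 2 * d + m2)) \<and>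
       2 * i + int (2 * q + 1) * j \<le> int (2 * k + 2 * (q + 1) * m1 + (2 * q + 1) * (2 * d + m2)) \<and>
       i + int q * j \<le> int (k + (q + 1) * m1 + (2 * q + 1) * d + q * m2)
       \<longleftrightarrow> 2 * i + int (2 * q + 1) * j \<le> N" if "0 \<le> i" "0 \<le> j" for i j
    proof -
      have coeff: "int (q + 1) = int q + 1" "int (2 * q + 1) = 2 * int q + 1" by simp_all
      have half: "z \<le> v \<longleftrightarrow> 2 * z \<le> 2 * v" for z v :: int by simp
      show ?thesis
        unfolding Y mid[unfolded Y] top half[of "i + int q * j"] right coeff
        by (rule *[OF that])
    qed
    show "{(i, j). 0 \<le> i \<and> 0 \<le> j \<and> j \<le> int (m1 + 2 * d + m2) \<and>
       i + int (q + 1) * j \<le> int (k + (q + 1) * (m1 + 2 * d + m2)) \<and>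
       2 * i + int (2 * q + 1) * j \<le> int (2 * k + 2 * (q + 1) * m1 + (2 * q + 1) * (2 * d + m2)) \<and>
       i + int q * j \<le> int (k + (q + 1) * m1 + (2 * q + 1) * d + q * m2)} = triangle 2 (int (2 * q + 1)) N"
      unfolding triangle_def using char by blast
  qed
qed

theorem proposition3p13:
  fixes p :: nat and c :: real and G :: generator
  assumes "odd p" and "p > 2" and "c > 0"
    and "minimal_for_ellipsoid (real p * c / 2) c G"
  shows "purely_elliptic G \<and>
    (\<exists>k m1 d m2 :: nat.
       m1 \<in> {0, 1} \<and> m2 \<in> {0, 1} \<and>
       (m1 = 1 \<longrightarrow> k < (p - 1) div 2) \<and>
       (m1 = 0 \<longrightarrow> k < (p + 1) div 2) \<and>
       formal_product G =
         replicate_mset k (1, 0) + replicate_mset m1 ((p + 1) div 2, 1) +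
         replicate_mset d (p, 2) + replicate_mset m2 ((p - 1) div 2, 1))"
proof
  show "purely_elliptic G" using assms(4) by (simp add: minimal_for_ellipsoid_def)
  from \<open>odd p\<close> obtain q where p: "p = 2 * q + 1" by (rule oddE)
  have q: "0 < q" using assms(2) p by simp
  \<comment> \<open>The scale \<open>c / 2\<close> leaves the integer weights 2 for \<open>x\<close>
    and \<open>p\<close> for \<open>y\<close>.\<close>
  have min: "minimal_for_ellipsoid (c / 2 * real_of_int (int p)) (c / 2 * real_of_int 2) G"
    using assms(4) by (simp add: mult.commute)
  obtain N where N: "0 \<le> N" "lattice_set (gpath G) = triangle 2 (int p) N"
    "c / 2 * real_of_int N \<le> ellipsoid_action (c / 2 * real_of_int (int p)) (c / 2 * real_of_int 2) G"
    by (rule minimal_lattice_set[OF _ _ _ min]) (use assms(2,3) in simp_all)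
  obtain k m1 d m2 :: nat where k: "m1 \<in> {0, 1}" "m2 \<in> {0, 1}" "m1 = 1 \<longrightarrow> k < q" "m1 = 0 \<longrightarrow> k < q + 1"
    and top: "int (2 * k + 2 * (q + 1) * m1 + (2 * q + 1) * (2 * d + m2)) \<le> N"
    and tri: "{(i, j). 0 \<le> i \<and> 0 \<le> j \<and> j \<le> int (m1 + 2 * d + m2) \<and>
       i + int (q + 1) * j \<le> int (k + (q + 1) * (m1 + 2 * d + m2)) \<and>
       2 * i + int (2 * q + 1) * j \<le> int (2 * k + 2 * (q + 1) * m1 + (2 * q + 1) * (2 * d + m2)) \<and>
       i + int q * j \<le> int (k + (q + 1) * m1 + (2 * q + 1) * d + q * m2)} = triangle 2 (int (2 * q + 1)) N"
    by (rule triangle_shape[OF q N(1)])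
  obtain G' where G': "convex_generator G'" "hedges G' = {}"
    "formal_product G' = replicate_mset k (1, 0) + replicate_mset m1 (q + 1, 1) +
       replicate_mset d (2 * q + 1, 2) + replicate_mset m2 (q, 1)"
    "lattice_set (gpath G') = triangle 2 (int (2 * q + 1)) N"
    "\<forall>(x, y)\<in>gpath G'.
       2 * x + real (2 * q + 1) * y \<le> real (2 * k + 2 * (q + 1) * m1 + (2 * q + 1) * (2 * d + m2))"
    using four_edge_generator[OF q, of k m1 d m2, unfolded tri] by blast
  have "ellipsoid_action (c / 2 * real_of_int (int p)) (c / 2 * real_of_int 2) G' \<le> c / 2 * real_of_int N"
  proof (rule ellipsoid_action_le)
    have "(0, 0) \<in> lattice_set (gpath G')" unfolding G'(4) using N(1) by (simp add: triangle_def)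
    then show "lattice_set (gpath G') \<noteq> {}" by blast
    fix x y assume "(x, y) \<in> gpath G'"
    then have "2 * x + real (2 * q + 1) * y \<le> real (2 * k + 2 * (q + 1) * m1 + (2 * q + 1) * (2 * d + m2))"
      using G'(5) by blast
    with top have "2 * x + real p * y \<le> real_of_int N" unfolding p by linarith
    then have "c / 2 * (2 * x + real p * y) \<le> c / 2 * real_of_int N"
      using assms(3) by (intro mult_left_mono) auto
    then show "c / 2 * real_of_int 2 * x + c / 2 * real_of_int (int p) * y \<le> c / 2 * real_of_int N"
      by (simp add: algebra_simps)
  qed
  then have "G' = G"
    using N(2,3) G' p by (intro minimal_generator_unique[OF min]) simp_all
  then show "\<exists>k m1 d m2 :: nat.
       m1 \<in> {0, 1} \<and> m2 \<in> {0, 1} \<and>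
       (m1 = 1 \<longrightarrow> k < (p - 1) div 2) \<and>
       (m1 = 0 \<longrightarrow> k < (p + 1) div 2) \<and>
       formal_product G =
         replicate_mset k (1, 0) + replicate_mset m1 ((p + 1) div 2, 1) +
         replicate_mset d (p, 2) + replicate_mset m2 ((p - 1) div 2, 1)"
    using k G'(3) by (intro exI[of _ k] exI[of _ m1] exI[of _ d] exI[of _ m2]) (simp add: p)
qed

end
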